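(* For any $p = (p_{00},p_{01},p_{10},p_{11}) \in \{0,1\}^4 \setminus \{(1,0,0,1),(0,1,1,0)\}$ and for any $\epsilon \in (0,1/2]$, the cellular automaton $p$ with error $\epsilon$ is ergodic.
   Context: PCA. Let $(p_{00},p_{01},p_{10},p_{11}) \in [0,1]^4$. The probabilistic cellular automaton (PCA) with parameter $(p_{00},p_{01},p_{10},p_{11})$ is the Markov chain $X(t) = (X_i(t))_{i \in \mathbb{Z}}$, $t \in \mathbb{N} = \{0,1,2,\dots\}$, on $\{0,1\}^{\mathbb{Z}}$ such that, for all $t \in \mathbb{N}$, conditionally on $X(t)$, the random variables $(X_i(t+1))_{i \in \mathbb{Z}}$ are independent and, for each $i \in \mathbb{Z}$, $$X_i(t+1) = \begin{cases} 0 & \text{with probability } 1 - p_{X_i(t)X_{i+1}(t)},\\ 1 & \text{with probability } p_{X_i(t)X_{i+1}(t)}. \end{cases}$$ The chain starts from an initial condition $X(0)$, which may be deterministic or distributed according to an initial probability measure $\mu_0$ on $\{0,1\}^{\mathbb{Z}}$. Cellular automaton with error. For $p = (p_{00},p_{01},p_{10},p_{11}) \in \{0,1\}^4$ and $\epsilon \in [0,1/2]$, the cellular automaton (CA) $p$ with error $\epsilon$ is the PCA with parameter $(p'_{00},p'_{01},p'_{10},p'_{11})$ where, for $x,y \in \{0,1\}$, $p'_{xy} = \epsilon$ if $p_{xy} = 0$ and $p'_{xy} = 1-\epsilon$ if $p_{xy} = 1$. Ergodicity. A PCA is called ergodic if there exists a probability measure $\mu_\infty$ on $\{0,1\}^{\mathbb{Z}}$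 such that, for any initial probability measure $\mu_0$ on $\{0,1\}^{\mathbb{Z}}$ with $X(0) \sim \mu_0$, the law $\mu_t$ of $X(t)$ converges weakly to $\mu_\infty$ as $t \to \infty$ ($\{0,1\}^{\mathbb{Z}}$ being equipped with the product topology). *)

theory Defs
  imports "HOL-Probability.Probability"
begin

text \<open>Configurations in \<open>{0,1}\<^sup>\<int>\<close>, with the states 0 and 1 encoded as \<^const>\<open>False\<close> and
  \<^const>\<open>True\<close>. The topology on \<^typ>\<open>bool\<close> is discrete and the one on functions is the product
  topology; \<^const>\<open>borel\<close> is then also the product sigma-algebra.\<close>

type_synonym config = "int \<Rightarrow> bool"

text \<open>A tuple \<open>(p\<^sub>0\<^sub>0, p\<^sub>0\<^sub>1, p\<^sub>1\<^sub>0, p\<^sub>1\<^sub>1)\<close>.\<close>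

type_synonym param = "real \<times> real \<times> real \<times> real"

fun entry :: "param \<Rightarrow> bool \<Rightarrow> bool \<Rightarrow> real" where
  "entry (p00, p01, p10, p11) x y =
     (if x then (if y then p11 else p10) else (if y then p01 else p00))"

text \<open>The transition kernel is only meaningful for parameters in \<open>[0,1]\<^sup>4\<close>
  (\<^const>\<open>bernoulli_pmf\<close> truncates its argument to the unit interval).\<close>

definition pca_kernel :: "param \<Rightarrow> config \<Rightarrow> config measure" where
  "pca_kernel p x =
     (\<Pi>\<^sub>M i\<in>UNIV. measure_pmf (bernoulli_pmf (entry p (x i) (x (i + 1)))))"

text \<open>The law of \<open>X(t)\<close> when \<open>X(0)\<close> has law \<open>\<mu>0\<close>. That \<^const>\<open>pca_kernel\<close> is a measurable
  Markov kernel, as required for \<open>\<bind>\<close> to have its intended meaning, is proved below.\<close>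

primrec pca_law :: "param \<Rightarrow> config measure \<Rightarrow> nat \<Rightarrow> config measure" where
  "pca_law p \<mu>0 0 = \<mu>0"
| "pca_law p \<mu>0 (Suc t) = pca_law p \<mu>0 t \<bind> pca_kernel p"

definition weakly_converges ::
    "(nat \<Rightarrow> 'a::topological_space measure) \<Rightarrow> 'a measure \<Rightarrow> bool" where
  "weakly_converges \<mu> \<nu> \<longleftrightarrow>
     (\<forall>f :: 'a \<Rightarrow> real. continuous_on UNIV f \<and> bounded (range f) \<longrightarrow>
        (\<lambda>t. LINT x|\<mu> t. f x) \<longlonglongrightarrow> (LINT x|\<nu>. f x))"

definition pca_ergodic :: "param \<Rightarrow> bool" where
  "pca_ergodic p \<longleftrightarrow>
     (\<exists>\<nu> \<in> space (prob_algebra borel). \<forall>\<mu>0 \<in> space (prob_algebra borel).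
        weakly_converges (pca_law p \<mu>0) \<nu>)"

definition noisy :: "real \<Rightarrow> real \<Rightarrow> real" where
  "noisy \<epsilon> q = (if q = 0 then \<epsilon> else 1 - \<epsilon>)"

text \<open>For \<open>p \<in> {0,1}\<^sup>4\<close>, the parameter of the cellular automaton \<open>p\<close> with error \<open>\<epsilon>\<close>.\<close>

fun ca_with_error :: "param \<Rightarrow> real \<Rightarrow> param" where
  "ca_with_error (p00, p01, p10, p11) \<epsilon> = (noisy \<epsilon> p00, noisy \<epsilon> p01, noisy \<epsilon> p10, noisy \<epsilon> p11)"

instance bool :: second_countable_topology
proof
  have "open = generate_topology (UNIV :: bool set set)"
    by (intro ext iffI) (auto intro: Topological_Spaces.open_discrete generate_topology.Basis)
  then show "\<exists>B::bool set set. countable B \<and> open = generate_topology B"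
    by (intro exI[of _ UNIV]) auto
qed

lemma sets_PiM_config:
  "sets (\<Pi>\<^sub>M i\<in>UNIV. count_space UNIV) = sets (borel :: config measure)"
proof -
  have "sets (\<Pi>\<^sub>M i\<in>(UNIV::int set). count_space (UNIV::bool set)) = sets (\<Pi>\<^sub>M i\<in>UNIV. borel)"
    by (rule sets_PiM_cong) (simp_all add: sets_borel_eq_count_space)
  then show ?thesis by (simp add: sets_PiM_equal_borel)
qed

lemma sets_pca_kernel: "sets (pca_kernel p x) = sets borel"
proof -
  have "sets (pca_kernel p x) = sets (\<Pi>\<^sub>M i\<in>(UNIV::int set). count_space (UNIV::bool set))"
    unfolding pca_kernel_def by (rule sets_PiM_cong) simp_all
  then show ?thesis by (simp add: sets_PiM_config)
qed

lemma prob_space_pca_kernel: "prob_space (pca_kernel p x)"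
  unfolding pca_kernel_def by (intro prob_space_PiM prob_space_measure_pmf)

lemma measurable_coordinate:
  "(\<lambda>x::config. x i) \<in> borel \<rightarrow>\<^sub>M count_space UNIV"
  using measurable_component_singleton[of i UNIV "\<lambda>_::int. count_space (UNIV::bool set)"]
  by (simp add: measurable_cong_sets[OF sets_PiM_config refl])

lemma measurable_pca_kernel: "pca_kernel p \<in> borel \<rightarrow>\<^sub>M prob_algebra borel"
proof (rule measurable_prob_algebra_generated
    [where \<Omega> = "UNIV" and G = "prod_algebra UNIV (\<lambda>_. count_space UNIV)"])
  show "sets (borel :: config measure) = sigma_sets UNIV (prod_algebra UNIV (\<lambda>_. count_space UNIV))"
    using sets_PiM[of UNIV "\<lambda>_::int. count_space (UNIV::bool set)"] by (simp add: sets_PiM_config)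
next
  show "Int_stable (prod_algebra (UNIV::int set) (\<lambda>_. count_space (UNIV::bool set)))"
    by (rule Int_stable_prod_algebra)
next
  show "prod_algebra UNIV (\<lambda>_. count_space UNIV) \<subseteq> Pow (UNIV :: config set)" by simp
next
  fix A :: "config set"
  assume "A \<in> prod_algebra UNIV (\<lambda>_. count_space UNIV)"
  then obtain J X where A: "A = prod_emb UNIV (\<lambda>_. count_space UNIV) J (\<Pi>\<^sub>E j\<in>J. X j)"
      and J: "finite J"
    by (rule prod_algebraE)
  have eq: "emeasure (pca_kernel p x) A =
      (\<Prod>j\<in>J. emeasure (measure_pmf (bernoulli_pmf (entry p (x j) (x (j + 1))))) (X j))" for x
  proof -
    interpret product_prob_space
      "\<lambda>i. measure_pmf (bernoulli_pmf (entry p (x i) (x (i + 1))))" UNIV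
      by (intro product_prob_spaceI prob_space_measure_pmf)
    have "A = prod_emb UNIV (\<lambda>i. measure_pmf (bernoulli_pmf (entry p (x i) (x (i + 1))))) J
        (\<Pi>\<^sub>E j\<in>J. X j)"
      by (simp add: A prod_emb_def)
    then show ?thesis
      unfolding pca_kernel_def using emeasure_PiM_emb[of J X] J by simp
  qed
  have "(\<lambda>x::config. emeasure (measure_pmf (bernoulli_pmf (entry p (x j) (x (j + 1))))) (X j))
      \<in> borel_measurable borel" for j
  proof -
    have "(\<lambda>x::config. (x j, x (j + 1))) \<in> borel \<rightarrow>\<^sub>M count_space UNIV \<Otimes>\<^sub>M count_space UNIV"
      by (intro measurable_Pair measurable_coordinate)
    then have "(\<lambda>x::config. (x j, x (j + 1))) \<in> borel \<rightarrow>\<^sub>M count_space UNIV"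
      by (simp add: pair_measure_countable)
    from measurable_compose[OF this, of "\<lambda>(a, b).
        emeasure (measure_pmf (bernoulli_pmf (entry p a b))) (X j)" borel]
    show ?thesis by simp
  qed
  then show "(\<lambda>x. emeasure (pca_kernel p x) A) \<in> borel_measurable borel"
    unfolding eq by (intro borel_measurable_prod_ennreal)
qed (simp_all add: prob_space_pca_kernel sets_pca_kernel)

lemma pca_law_in_prob_algebra:
  assumes "\<mu>0 \<in> space (prob_algebra borel)"
  shows "pca_law p \<mu>0 t \<in> space (prob_algebra borel)"
proof (induction t)
  case 0
  then show ?case using assms by simp
next
  case (Suc t)
  have "(\<lambda>\<mu>. \<mu> \<bind> pca_kernel p) \<in> prob_algebra borel \<rightarrow>\<^sub>M prob_algebra borel"
    by (rule measurable_bind_prob_space[OF measurable_ident_sets[OF refl, unfolded id_def]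
          measurable_pca_kernel])
  from measurable_space[OF this Suc] show ?case by simp
qed

end

theory Submission
  imports Defs
begin

text \<open>Split a noisy update into an overwriting with 0 or 1 (probability \<open>\<epsilon>\<close> each) and an exact
  application of the rule. Add a state "unknown", written \<open>?\<close>, for cells whose value may depend
  on the initial condition, and start with all cells unknown. If the density \<open>Q\<close> of unknown
  cells tends to 0, the automaton is ergodic. Rules depending on at most one input satisfy
  \<open>Q' \<le> (1 - 2\<epsilon>) Q\<close>. For \<open>x \<and> \<not>y\<close> and its relatives \<open>Q + P(1?)\<close> contracts by
  \<open>(1 - 2\<epsilon>)(1 + \<epsilon>)\<close>, and for NAND and NOR a weighted sum of the densities of \<open>?\<close>, \<open>?1\<close>,
  \<open>?10\<close>, \<open>1?\<close>, \<open>01?\<close> contracts by \<open>1 - 4\<epsilon>\<^sup>2\<close>. For AND and OR one uses duality instead: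
  the probability that all cells of a finite set equal 1 (for OR, 0) is, up to a constant, a nonnegative
  combination of such probabilities one step earlier with total weight at most \<open>1 - \<epsilon>\<close>,
  because a single overwriting with the opposite symbol decides the event.\<close>

section \<open>The automaton with unknown cells\<close>

text \<open>\<^const>\<open>None\<close> stands for a cell whose state may depend on the initial condition;
  \<open>lift_rule f\<close> keeps an output known when \<open>f\<close> ignores the unknown input.\<close>

definition refines :: "'a option \<Rightarrow> 'a option \<Rightarrow> bool" where
  "refines a b \<longleftrightarrow> b = None \<or> a = b"

definition lift_rule :: "(bool \<Rightarrow> bool \<Rightarrow> bool) \<Rightarrow> bool option \<Rightarrow> bool option \<Rightarrow> bool option" where
  "lift_rule f a b = (case a of
      None \<Rightarrow> (case b of None \<Rightarrow> None
        | Some y \<Rightarrow> if f True y = f False y then Some (f True y) else None)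
    | Some x \<Rightarrow> (case b of None \<Rightarrow> if f x True = f x False then Some (f x True) else None
        | Some y \<Rightarrow> Some (f x y)))"

lemma lift_rule_simps [simp]:
  "lift_rule f (Some x) (Some y) = Some (f x y)"
  "lift_rule f None (Some y) = (if f True y = f False y then Some (f True y) else None)"
  "lift_rule f (Some x) None = (if f x True = f x False then Some (f x True) else None)"
  "lift_rule f None None = None"
  by (simp_all add: lift_rule_def)

text \<open>Forgetting an input can make the output unknown but never alters a known output. This
  monotonicity carries the coupling below.\<close>

lemma lift_rule_mono:
  assumes "refines a a'" "refines b b'"
  shows "refines (lift_rule f a b) (lift_rule f a' b')"
proof -
  have "refines (lift_rule f a b) (lift_rule f None b)"
    by (cases a; cases b) (auto simp: refines_def, (metis (full_types))+)
  moreover have "refines (lift_rule f a b) (lift_rule f a None)"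
    by (cases a; cases b) (auto simp: refines_def, (metis (full_types))+)
  moreover have "lift_rule f None None = None" "refines x None" for x :: "bool option"
    by (simp_all add: refines_def)
  ultimately show ?thesis
    using assms unfolding refines_def by metis
qed

locale noisy_rule =
  fixes f :: "bool \<Rightarrow> bool \<Rightarrow> bool" and \<epsilon> :: real
  assumes eps: "0 < \<epsilon>" "\<epsilon> \<le> 1/2"
begin

definition \<eta> :: real where "\<eta> = 1 - 2 * \<epsilon>"

lemma eta_nonneg: "0 \<le> \<eta>"
  using eps by (simp add: \<eta>_def)

lemma weights_sum: "2 * (\<epsilon> * c) + \<eta> * c = c"
  by (simp add: \<eta>_def algebra_simps)

text \<open>Each cell is overwritten with 1, overwritten with 0, or updated by the rule, with
  probabilities \<open>\<epsilon>\<close>, \<open>\<epsilon>\<close>, \<open>1 - 2\<epsilon>\<close>. Then \<open>step g v\<close> is the expectation of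
  \<open>g\<close> at the word of length \<open>n\<close> produced in one step from the word \<open>v\<close> of length \<open>n + 1\<close>.\<close>

fun step :: "(bool option list \<Rightarrow> real) \<Rightarrow> bool option list \<Rightarrow> real" where
  "step g (a # b # v) =
     \<epsilon> * step (\<lambda>w. g (Some True # w)) (b # v) + \<epsilon> * step (\<lambda>w. g (Some False # w)) (b # v) +
     \<eta> * step (\<lambda>w. g (lift_rule f a b # w)) (b # v)"
| "step g [a] = g []"
| "step g [] = g []"

lemma step_const [simp]: "step (\<lambda>_. c) v = c"
  by (induction "\<lambda>_::bool option list. c" v rule: step.induct) (simp_all add: weights_sum)

lemma step_add: "step (\<lambda>w. g w + h w) v = step g v + step h v"
  by (induction g v arbitrary: h rule: step.induct) (simp_all, simp add: algebra_simps)

lemma step_cmult: "step (\<lambda>w. c * g w) v = c * step g v"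
  by (induction g v rule: step.induct) (simp_all add: algebra_simps)

text \<open>The hypothesis is restricted to length \<open>n\<close> because \<open>step\<close>
  evaluates \<open>g\<close> only there; later pattern inequalities hold only on words of the right
  length.\<close>

lemma step_mono:
  "(\<And>w. length w = n \<Longrightarrow> g w \<le> h w) \<Longrightarrow> length v = Suc n \<Longrightarrow> step g v \<le> step h v"
proof (induction g v arbitrary: h n rule: step.induct)
  case (1 g a b v)
  then obtain m where m: "n = Suc m" by (cases n) auto
  have "length (b # v) = Suc m" "\<And>c w. length w = m \<Longrightarrow> g (c # w) \<le> h (c # w)"
    using "1.prems" m by auto
  note IH = "1.IH"[OF this(2,1)]
  show ?case
    unfolding step.simps using eps eta_nonneg by (intro add_mono mult_left_mono IH) auto
qed auto

lemma step_cong: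
  "(\<And>w. length w = n \<Longrightarrow> g w = h w) \<Longrightarrow> length v = Suc n \<Longrightarrow> step g v = step h v"
  using step_mono[of n g h v] step_mono[of n h g v] by force

text \<open>An output cell that \<open>g\<close> ignores is integrated out with total weight 1.
  Together with \<open>step_butlast\<close> this gives the marginals of a window.\<close>

lemma step_tl: "v \<noteq> [] \<Longrightarrow> step (\<lambda>w. g (tl w)) (a # v) = step g v"
  by (cases v) (simp_all add: weights_sum)

lemma step_butlast: "v \<noteq> [] \<Longrightarrow> step (\<lambda>w. g (butlast w)) (v @ [b]) = step g v"
proof (induction g v rule: step.induct)
  case (1 g a c v)
  have *: "step (\<lambda>w. g (butlast (x # w))) (c # v @ [b]) = step (\<lambda>w. g (x # butlast w)) (c # v @ [b])" for x
    by (rule step_cong[where n="Suc (length v)"]) auto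
  show ?case
    unfolding append_Cons step.simps * using 1 by simp
next
  case (2 g a)
  then show ?case by (simp add: weights_sum)
qed auto

text \<open>The three words are updated with the same choice (overwrite with 1, overwrite with 0,
  apply the rule) at every cell. By \<open>lift_rule_mono\<close> the outputs of \<open>v\<close>
  and \<open>v'\<close> still refine that of \<open>u\<close>, so the pointwise bound can be
  averaged.\<close>

lemma step_coupling:
  assumes "\<And>w w' u. \<lbrakk>length u = n; list_all2 refines w u; list_all2 refines w' u\<rbrakk> \<Longrightarrow> g w - g' w' \<le> h u"
    and "length u = Suc n" "list_all2 refines v u" "list_all2 refines v' u"
  shows "step g v - step g' v' \<le> step h u"
  using assms
proof (induction h u arbitrary: g g' n v v' rule: step.induct)
  case (1 h a b u)
  obtain m where m: "n = Suc m" using "1.prems" by (cases n) auto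
  obtain x y v1 where v: "v = x # y # v1" and xy: "refines x a" "refines y b" "list_all2 refines v1 u"
    using "1.prems" by (auto simp: list_all2_Cons2)
  obtain x' y' v1' where v': "v' = x' # y' # v1'"
    and xy': "refines x' a" "refines y' b" "list_all2 refines v1' u"
    using "1.prems" by (auto simp: list_all2_Cons2)
  \<comment> \<open>Here \<open>d\<close> is the first output cell of \<open>u\<close> under a
    common choice, \<open>c\<close> and \<open>c'\<close> are those of \<open>v\<close> and
    \<open>v'\<close>; the induction hypothesis for that choice covers the remaining cells.\<close>
  have *: "step (\<lambda>w. g (c # w)) (y # v1) - step (\<lambda>w. g' (c' # w)) (y' # v1') \<le> step (\<lambda>w. h (d # w)) (b # u)"
    if d: "d \<in> {Some True, Some False, lift_rule f a b}" and c: "refines c d" "refines c' d" for c c' d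
  proof -
    have gh: "g (c # w) - g' (c' # w') \<le> h (d # z)"
      if "length z = m" "list_all2 refines w z" "list_all2 refines w' z" for w w' z
      using "1.prems"(1)[of "d # z" "c # w" "c' # w'"] that c m by simp
    have len: "length (b # u) = Suc m" "list_all2 refines (y # v1) (b # u)" "list_all2 refines (y' # v1') (b # u)"
      using "1.prems" m xy xy' by auto
    consider "d = Some True" | "d = Some False" | "d = lift_rule f a b" using d by blast
    then show ?thesis
    proof cases
      case 1
      show ?thesis using gh unfolding 1 by (intro "1.IH"(1)[OF _ len])
    next
      case 2
      show ?thesis using gh unfolding 2 by (intro "1.IH"(2)[OF _ len])
    next
      case 3
      show ?thesis using gh unfolding 3 by (intro "1.IH"(3)[OF _ len])
    qed
  qed
  have r: "refines c c" for c :: "bool option" by (simp add: refines_def)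
  have "\<epsilon> * (step (\<lambda>w. g (Some True # w)) (y # v1) - step (\<lambda>w. g' (Some True # w)) (y' # v1'))
      + \<epsilon> * (step (\<lambda>w. g (Some False # w)) (y # v1) - step (\<lambda>w. g' (Some False # w)) (y' # v1'))
      + \<eta> * (step (\<lambda>w. g (lift_rule f x y # w)) (y # v1) - step (\<lambda>w. g' (lift_rule f x' y' # w)) (y' # v1'))
      \<le> step h (a # b # u)"
    unfolding step.simps using eps eta_nonneg xy xy' r
    by (intro add_mono mult_left_mono *) (auto intro: lift_rule_mono)
  then show ?case by (simp add: v v' algebra_simps)
qed (auto simp: list_all2_Cons2)

section \<open>Several time steps\<close>

lemma funpow_step_const [simp]: "(step ^^ t) (\<lambda>_. c) = (\<lambda>_. c)"
  by (induction t) auto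

lemma funpow_step_add: "(step ^^ t) (\<lambda>w. g w + h w) = (\<lambda>v. (step ^^ t) g v + (step ^^ t) h v)"
  by (induction t) (auto simp: step_add)

lemma funpow_step_cmult: "(step ^^ t) (\<lambda>w. c * g w) = (\<lambda>v. c * (step ^^ t) g v)"
  by (induction t) (auto simp: step_cmult)

lemma funpow_step_mono:
  "(\<And>w. length w = n \<Longrightarrow> g w \<le> h w) \<Longrightarrow> length v = n + t \<Longrightarrow> (step ^^ t) g v \<le> (step ^^ t) h v"
proof (induction t arbitrary: v)
  case (Suc t)
  then show ?case
    using step_mono[of "n + t" "(step ^^ t) g" "(step ^^ t) h" v] by simp
qed simp

lemma funpow_step_cong:
  "(\<And>w. length w = n \<Longrightarrow> g w = h w) \<Longrightarrow> length v = n + t \<Longrightarrow> (step ^^ t) g v = (step ^^ t) h v"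
  using funpow_step_mono[of n g h v t] funpow_step_mono[of n h g v t] by force

lemma funpow_step_tl:
  assumes "length v = n + t"
  shows "(step ^^ t) (\<lambda>w. g (tl w)) (a # v) = (step ^^ t) g v"
  using assms
proof (induction t arbitrary: v a)
  case (Suc t)
  have "step ((step ^^ t) (\<lambda>w. g (tl w))) (a # v) = step (\<lambda>w. (step ^^ t) g (tl w)) (a # v)"
  proof (rule step_cong[where n="Suc (n + t)"])
    fix w :: "bool option list" assume "length w = Suc (n + t)"
    then show "(step ^^ t) (\<lambda>w. g (tl w)) w = (step ^^ t) g (tl w)"
      using Suc.IH by (cases w) auto
  qed (use Suc in simp)
  also have "\<dots> = step ((step ^^ t) g) v"
    using Suc.prems by (intro step_tl) auto
  finally show ?case by simp
qed simp

lemma funpow_step_butlast: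
  assumes "length v = n + t"
  shows "(step ^^ t) (\<lambda>w. g (butlast w)) (v @ [b]) = (step ^^ t) g v"
  using assms
proof (induction t arbitrary: v b)
  case (Suc t)
  have "step ((step ^^ t) (\<lambda>w. g (butlast w))) (v @ [b]) = step (\<lambda>w. (step ^^ t) g (butlast w)) (v @ [b])"
  proof (rule step_cong[where n="Suc (n + t)"])
    fix w :: "bool option list" assume "length w = Suc (n + t)"
    then show "(step ^^ t) (\<lambda>w. g (butlast w)) w = (step ^^ t) g (butlast w)"
      using Suc.IH[of "butlast w" "last w"] by (cases w rule: rev_cases) auto
  qed (use Suc in simp)
  also have "\<dots> = step ((step ^^ t) g) v"
    using Suc.prems by (intro step_butlast) auto
  finally show ?case by simp
qed simp

lemma funpow_step_coupling:
  assumes "\<And>w w' u. \<lbrakk>length u = n; list_all2 refines w u; list_all2 refines w' u\<rbrakk> \<Longrightarrow> g w - g' w' \<le> h u"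
    and "length u = n + t" "list_all2 refines v u" "list_all2 refines v' u"
  shows "(step ^^ t) g v - (step ^^ t) g' v' \<le> (step ^^ t) h u"
  using assms(2-)
proof (induction t arbitrary: u v v')
  case 0
  then show ?case using assms(1) by simp
next
  case (Suc t)
  have "step ((step ^^ t) g) v - step ((step ^^ t) g') v' \<le> step ((step ^^ t) h) u"
    by (rule step_coupling[where n="n + t"]) (use Suc in auto)
  then show ?case by simp
qed

text \<open>\<open>E n t\<close> is the expectation over a window of \<open>n\<close> cells at time \<open>t\<close> when all cells are
  unknown at time 0. As only the size of the window enters, translation invariance is built in.\<close>

definition E :: "nat \<Rightarrow> nat \<Rightarrow> (bool option list \<Rightarrow> real) \<Rightarrow> real" where
  "E n t g = (step ^^ t) g (replicate (n + t) None)"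

lemma E_const [simp]: "E n t (\<lambda>_. c) = c"
  by (simp add: E_def)

lemma E_add: "E n t (\<lambda>w. g w + h w) = E n t g + E n t h"
  by (simp add: E_def funpow_step_add)

lemma E_cmult: "E n t (\<lambda>w. c * g w) = c * E n t g"
  by (simp add: E_def funpow_step_cmult)

lemma E_mono: "(\<And>w. length w = n \<Longrightarrow> g w \<le> h w) \<Longrightarrow> E n t g \<le> E n t h"
  unfolding E_def by (rule funpow_step_mono) auto

lemma E_cong: "(\<And>w. length w = n \<Longrightarrow> g w = h w) \<Longrightarrow> E n t g = E n t h"
  unfolding E_def by (rule funpow_step_cong) auto

lemma E_tl: "E (Suc n) t (\<lambda>w. g (tl w)) = E n t g"
  unfolding E_def using funpow_step_tl[of "replicate (n + t) None" n t g None] by simp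

lemma E_butlast: "E (Suc n) t (\<lambda>w. g (butlast w)) = E n t g"
  unfolding E_def using funpow_step_butlast[of "replicate (n + t) None" n t g None]
  by (simp add: replicate_append_same)

lemma E_Suc: "E n (Suc t) g = E (Suc n) t (step g)"
  by (simp add: E_def funpow_swap1)

section \<open>Pattern probabilities and loss of memory\<close>

definition P :: "nat \<Rightarrow> bool option list \<Rightarrow> real" where
  "P t u = E (length u) t (\<lambda>w. of_bool (w = u))"

lemma P_nonneg: "0 \<le> P t u"
  using E_mono[of "length u" "\<lambda>_. 0" "\<lambda>w. of_bool (w = u)" t] by (simp add: P_def)

abbreviation unknown :: "bool option list \<Rightarrow> real" where
  "unknown u \<equiv> (\<Sum>a\<leftarrow>u. of_bool (a = None))"

lemma E_hd: "E (Suc n) t (\<lambda>w. of_bool (hd w = None)) = P t [None]"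
proof (induction n)
  case 0
  show ?case unfolding P_def length_Cons list.size(3)
    by (rule E_cong) (auto simp: length_Suc_conv)
next
  case (Suc n)
  have "E (Suc (Suc n)) t (\<lambda>w. of_bool (hd w = None)) = E (Suc (Suc n)) t (\<lambda>w. of_bool (hd (butlast w) = None))"
    by (rule E_cong) (auto simp: length_Suc_conv)
  then show ?case using Suc E_butlast[of "Suc n" t "\<lambda>w. of_bool (hd w = None)"] by simp
qed

lemma E_unknown: "E n t unknown = n * P t [None]"
proof (induction n)
  case 0
  have "E 0 t unknown = E 0 t (\<lambda>_. 0)" by (rule E_cong) auto
  then show ?case by simp
next
  case (Suc n)
  have "E (Suc n) t unknown = E (Suc n) t (\<lambda>w. of_bool (hd w = None) + unknown (tl w))"
    by (rule E_cong) (auto simp: length_Suc_conv)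
  also have "\<dots> = P t [None] + n * P t [None]"
    by (simp add: E_add E_hd E_tl[of n t unknown] Suc)
  finally show ?case by (simp add: algebra_simps)
qed

text \<open>Both words refine the all-unknown word. In the coupling the outputs coincide when the
  output window has no unknown cell, and otherwise the difference is at most \<open>2 * M\<close>;
  the expected number of unknown cells bounds the probability of the latter.\<close>

lemma oscillation_bound:
  assumes M: "\<And>w. \<bar>g w\<bar> \<le> M" and v: "length v = n + t" "length v' = n + t"
  shows "(step ^^ t) g v - (step ^^ t) g v' \<le> 2 * M * n * P t [None]"
proof -
  have M0: "0 \<le> M" using M[of "[]"] by linarith
  have h: "g w - g w' \<le> 2 * M * unknown u"
    if "length u = n" "list_all2 refines w u" "list_all2 refines w' u" for w w' u
  proof (cases "None \<in> set u")
    case True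
    then have "1 \<le> unknown u"
    proof (induction u)
      case (Cons a u)
      moreover have "0 \<le> unknown u" by (rule sum_list_nonneg) auto
      ultimately show ?case by auto
    qed simp
    then have "2 * M * 1 \<le> 2 * M * unknown u" using M0 by (intro mult_left_mono) auto
    then show ?thesis using M[of w] M[of w'] by linarith
  next
    case False
    have "w = u" if "list_all2 refines w u" for w
      using that False by (induction rule: list_all2_induct) (auto simp: refines_def)
    then have "w = u" "w' = u" using that by auto
    moreover have "0 \<le> unknown u" by (rule sum_list_nonneg) auto
    ultimately show ?thesis using M0 by simp
  qed
  have "(step ^^ t) g v - (step ^^ t) g v' \<le> (step ^^ t) (\<lambda>u. 2 * M * unknown u) (replicate (n + t) None)"
    by (rule funpow_step_coupling[where n=n]) (use h v in \<open>auto simp: list_all2_conv_all_nth refines_def\<close>)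
  also have "\<dots> = E n t (\<lambda>u. 2 * M * unknown u)" by (simp only: E_def)
  also have "\<dots> = 2 * M * (n * P t [None])" by (subst E_cmult) (simp only: E_unknown)
  finally show ?thesis by simp
qed

text \<open>The criterion to which every rule is reduced. It is uniform over known words, hence over
  initial laws. A single time \<open>t\<close> suffices, because a later law is again a law after
  \<open>t\<close> steps from another initial law.\<close>

definition forgets :: bool where
  "forgets \<longleftrightarrow> (\<forall>n g e. 0 < e \<longrightarrow> (\<exists>t. \<forall>v v'. length v = n + t \<longrightarrow> length v' = n + t \<longrightarrow>
      \<bar>(step ^^ t) g (map Some v) - (step ^^ t) g (map Some v')\<bar> \<le> e))"

lemma forgetsI_unknown:
  assumes "(\<lambda>t. P t [None]) \<longlonglongrightarrow> 0"
  shows forgets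
  unfolding forgets_def
proof (intro allI impI)
  fix n and g :: "bool option list \<Rightarrow> real" and e :: real assume e: "0 < e"
  \<comment> \<open>\<open>oscillation_bound\<close> asks for a bound on all words. Cutting
    \<open>g\<close> off outside length \<open>n\<close> leaves finitely many values and does not
    change the averages.\<close>
  define g' where "g' = (\<lambda>w. if length w = n then g w else 0)"
  define M where "M = Max (insert 0 (abs ` g ` {w :: bool option list. length w = n}))"
  have fin: "finite {w :: bool option list. length w = n}"
    using finite_lists_length_eq[of "UNIV :: bool option set" n] by simp
  have M: "\<bar>g' w\<bar> \<le> M" for w
    using fin unfolding M_def g'_def by (auto intro!: Max_ge)
  have "(\<lambda>t. 2 * M * n * P t [None]) \<longlonglongrightarrow> 2 * M * n * 0"
    by (intro tendsto_intros assms)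
  then have "(\<lambda>t. 2 * M * n * P t [None]) \<longlonglongrightarrow> 0" by simp
  then have "\<forall>\<^sub>F t in sequentially. 2 * M * n * P t [None] < e" using e by (rule order_tendstoD(2))
  then obtain t where t: "2 * M * n * P t [None] < e"
    by (auto simp: eventually_sequentially)
  show "\<exists>t. \<forall>v v'. length v = n + t \<longrightarrow> length v' = n + t \<longrightarrow>
      \<bar>(step ^^ t) g (map Some v) - (step ^^ t) g (map Some v')\<bar> \<le> e"
  proof (intro exI allI impI)
    fix v v' :: "bool list" assume v: "length v = n + t" "length v' = n + t"
    have "(step ^^ t) g (map Some v) = (step ^^ t) g' (map Some v)"
      "(step ^^ t) g (map Some v') = (step ^^ t) g' (map Some v')"
      by (rule funpow_step_cong[of n]; use v in \<open>auto simp: g'_def\<close>)+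
    then show "\<bar>(step ^^ t) g (map Some v) - (step ^^ t) g (map Some v')\<bar> \<le> e"
      using oscillation_bound[of g' M "map Some v" n t "map Some v'"]
        oscillation_bound[of g' M "map Some v'" n t "map Some v"] M v t by auto
  qed
qed

text \<open>\<open>V\<close> acts as a Lyapunov function: its geometric decay forces the density of
  unknown cells to 0.\<close>

lemma forgetsI_contraction:
  assumes "\<And>t. P t [None] \<le> V t" and "\<And>t. V (Suc t) \<le> \<rho> * V t" and "0 \<le> \<rho>" "\<rho> < 1"
  shows forgets
proof (rule forgetsI_unknown)
  have V: "V t \<le> \<rho> ^ t * V 0" for t
  proof (induction t)
    case (Suc t)
    have "V (Suc t) \<le> \<rho> * V t" by (rule assms)
    also have "\<dots> \<le> \<rho> * (\<rho> ^ t * V 0)" using Suc assms by (intro mult_left_mono)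
    finally show ?case by simp
  qed simp
  have lim: "(\<lambda>t. \<rho> ^ t * V 0) \<longlonglongrightarrow> 0"
    using assms by (auto intro!: tendsto_mult_left_zero LIMSEQ_power_zero)
  have "P t [None] \<le> \<rho> ^ t * V 0" for t
    using assms(1)[of t] V[of t] by linarith
  then show "(\<lambda>t. P t [None]) \<longlonglongrightarrow> 0"
    using P_nonneg by (intro tendsto_sandwich[OF _ _ tendsto_const lim] always_eventually allI)
qed

end

section \<open>Contraction for the individual rules\<close>

context noisy_rule
begin

section \<open>Evolution of short patterns\<close>

lemma P_Suc: "P (Suc t) u = E (Suc (length u)) t (step (\<lambda>w. of_bool (w = u)))"
  by (simp add: P_def E_Suc)

text \<open>A known value is the target of exactly one of the two overwritings and
  \<open>None\<close> of neither, which gives the first term.\<close>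

definition transition :: "bool option \<Rightarrow> bool option \<Rightarrow> bool option \<Rightarrow> real" where
  "transition a b c = \<epsilon> * of_bool (c \<noteq> None) + \<eta> * of_bool (lift_rule f a b = c)"

text \<open>Given the input word, the output cells are independent, so the probability of a pattern
  factors. Inequalities between short patterns thereby become finite case distinctions.\<close>

lemma step_indicator:
  "step (\<lambda>w. of_bool (w = c # u)) (a # b # v) = transition a b c * step (\<lambda>w. of_bool (w = u)) (b # v)"
proof -
  have *: "step (\<lambda>w. of_bool (d # w = c # u)) (b # v) = of_bool (d = c) * step (\<lambda>w. of_bool (w = u)) (b # v)" for d
    using step_cmult[of "of_bool (d = c)" "\<lambda>w. of_bool (w = u)" "b # v"] by (simp only: of_bool_conj list.inject)
  show ?thesis
    unfolding step.simps * by (cases c) (auto simp: transition_def algebra_simps of_bool_def)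
qed

lemma P_butlast: "E (Suc (length u)) t (\<lambda>w. of_bool (butlast w = u)) = P t u"
  using E_butlast[of "length u" t "\<lambda>w. of_bool (w = u)"] by (simp add: P_def)

lemma P_tl: "E (Suc (length u)) t (\<lambda>w. of_bool (tl w = u)) = P t u"
  using E_tl[of "length u" t "\<lambda>w. of_bool (w = u)"] by (simp add: P_def)

text \<open>Recognises a pattern probability at time \<open>Suc t\<close> in an average over a
  larger window at time \<open>t\<close>, so that a long pattern can be bounded by a shorter one at
  the same later time.\<close>

lemma P_Suc_butlast:
  "E (Suc (Suc (length u))) t (\<lambda>w. step (\<lambda>w. of_bool (w = u)) (butlast w)) = P (Suc t) u"
  by (simp add: P_Suc E_butlast)

lemma P_Suc_tl:
  "E (Suc (Suc (length u))) t (\<lambda>w. step (\<lambda>w. of_bool (w = u)) (tl w)) = P (Suc t) u"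
  by (simp add: P_Suc E_tl)

lemma P_Suc_butlast_butlast:
  "E (Suc (Suc (Suc (length u)))) t (\<lambda>w. step (\<lambda>w. of_bool (w = u)) (butlast (butlast w))) = P (Suc t) u"
  by (simp add: E_butlast[of _ _ "\<lambda>w. step (\<lambda>w. of_bool (w = u)) (butlast w)"] P_Suc_butlast)

lemma P_Suc_tl_tl:
  "E (Suc (Suc (Suc (length u)))) t (\<lambda>w. step (\<lambda>w. of_bool (w = u)) (tl (tl w))) = P (Suc t) u"
  by (simp add: E_tl[of _ _ "\<lambda>w. step (\<lambda>w. of_bool (w = u)) (tl w)"] P_Suc_tl)

lemmas P_simps =
  P_Suc_butlast_butlast[where u="[a]" for a, simplified] P_Suc_tl_tl[where u="[a]" for a, simplified] P_butlast[where u="[a]" for a, simplified] P_tl[where u="[a]" for a, simplified]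
  P_butlast[where u="[a, b]" for a b, simplified] P_tl[where u="[a, b]" for a b, simplified]
  P_def[where u="[a, b]" for a b, simplified, symmetric]
  P_def[where u="[a, b, c]" for a b c, simplified, symmetric]
  P_Suc_butlast[where u="[a]" for a, simplified] P_Suc_tl[where u="[a]" for a, simplified]
  P_Suc_butlast[where u="[a, b]" for a b, simplified] P_Suc_tl[where u="[a, b]" for a b, simplified]
  E_add E_cmult

text \<open>An output is unknown only if it is not overwritten and the one input that can matter is
  unknown.\<close>

lemma forgets_one_sided:
  assumes "(\<forall>x y z. f x y = f x z) \<or> (\<forall>x y z. f x z = f y z)"
  shows forgets
proof (rule forgetsI_contraction[of "\<lambda>t. P t [None]" \<eta>])
  show "P (Suc t) [None] \<le> \<eta> * P t [None]" for t
    using assms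
  proof
    assume *: "\<forall>x y z. f x y = f x z"
    have "P (Suc t) [None] \<le> E (Suc (Suc 0)) t (\<lambda>w. \<eta> * of_bool (butlast w = [None]))"
      unfolding P_Suc length_Cons list.size(3)
    proof (rule E_mono)
      fix w :: "bool option list" assume "length w = Suc (Suc 0)"
      then show "step (\<lambda>w. of_bool (w = [None])) w \<le> \<eta> * of_bool (butlast w = [None])"
        using eta_nonneg * by (auto simp: length_Suc_conv step_indicator transition_def lift_rule_def split: option.splits)
    qed
    then show ?thesis by (simp add: P_simps)
  next
    assume *: "\<forall>x y z. f x z = f y z"
    have "P (Suc t) [None] \<le> E (Suc (Suc 0)) t (\<lambda>w. \<eta> * of_bool (tl w = [None]))"
      unfolding P_Suc length_Cons list.size(3)
    proof (rule E_mono)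
      fix w :: "bool option list" assume "length w = Suc (Suc 0)"
      then show "step (\<lambda>w. of_bool (w = [None])) w \<le> \<eta> * of_bool (tl w = [None])"
        using eta_nonneg * by (auto simp: length_Suc_conv step_indicator transition_def lift_rule_def split: option.splits)
    qed
    then show ?thesis by (simp add: P_simps)
  qed
qed (use eps in \<open>auto simp: \<eta>_def\<close>)

text \<open>The left neighbour of an unknown output can be \<open>\<alpha>\<close> only by an error, so patterns
  \<open>\<alpha> ?\<close> make up at most the fraction \<open>\<epsilon>\<close> of the unknown cells.\<close>

lemma forgets_shift_type:
  assumes f: "\<And>x y. f x y = (if x = \<alpha> \<and> y \<noteq> \<alpha> then \<alpha> else \<not> \<alpha>)"
  shows forgets
proof (rule forgetsI_contraction[of "\<lambda>t. P t [None] + P t [Some \<alpha>, None]" "\<eta> * (1 + \<epsilon>)"])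
  have f': "f x y \<longleftrightarrow> (if \<alpha> then x \<and> \<not> y else x \<or> \<not> y)" for x y
    using f[of x y] by auto
  fix t
  \<comment> \<open>A left input \<not>\<alpha> or a right input \<alpha> fixes the exact output. So
    it is unknown only if the left input is, or if the left input is \<alpha> and the right one is
    unknown.\<close>
  have "P (Suc t) [None] \<le> E (Suc (Suc 0)) t (\<lambda>w. \<eta> * (of_bool (butlast w = [None]) + of_bool (w = [Some \<alpha>, None])))"
    unfolding P_Suc length_Cons list.size(3)
  proof (rule E_mono)
    fix w :: "bool option list" assume "length w = Suc (Suc 0)"
    then show "step (\<lambda>w. of_bool (w = [None])) w \<le> \<eta> * (of_bool (butlast w = [None]) + of_bool (w = [Some \<alpha>, None]))"
      using eta_nonneg by (cases \<alpha>; auto simp: length_Suc_conv step_indicator transition_def lift_rule_def f' of_bool_def split: option.splits if_splits)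
  qed
  then have 1: "P (Suc t) [None] \<le> \<eta> * (P t [None] + P t [Some \<alpha>, None])" by (simp add: P_simps)
  \<comment> \<open>An unknown right output forces the middle input to be \<open>?\<close> or
    \<alpha>, whereas an exact left output \<alpha> requires the middle input
    \<not>\<alpha>.\<close>
  have "P (Suc t) [Some \<alpha>, None] \<le> E (Suc (Suc (Suc 0))) t (\<lambda>w. \<epsilon> * step (\<lambda>w. of_bool (w = [None])) (tl w))"
    unfolding P_Suc length_Cons list.size(3)
  proof (rule E_mono)
    fix w :: "bool option list" assume "length w = Suc (Suc (Suc 0))"
    then show "step (\<lambda>w. of_bool (w = [Some \<alpha>, None])) w \<le> \<epsilon> * step (\<lambda>w. of_bool (w = [None])) (tl w)"
      using eps eta_nonneg
      by (cases \<alpha>; auto simp: length_Suc_conv step_indicator transition_def lift_rule_def f' of_bool_def split: option.splits if_splits)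
  qed
  then have "P (Suc t) [Some \<alpha>, None] \<le> \<epsilon> * P (Suc t) [None]" by (simp add: P_simps)
  then have "P (Suc t) [None] + P (Suc t) [Some \<alpha>, None] \<le> (1 + \<epsilon>) * P (Suc t) [None]"
    by (simp add: algebra_simps)
  also have "\<dots> \<le> (1 + \<epsilon>) * (\<eta> * (P t [None] + P t [Some \<alpha>, None]))"
    using 1 eps by (intro mult_left_mono) auto
  finally show "P (Suc t) [None] + P (Suc t) [Some \<alpha>, None] \<le> \<eta> * (1 + \<epsilon>) * (P t [None] + P t [Some \<alpha>, None])"
    by (simp add: mult_ac)
next
  have "\<eta> * (1 + \<epsilon>) = 1 - \<epsilon> - 2 * \<epsilon>\<^sup>2"
    by (simp add: \<eta>_def power2_eq_square algebra_simps)
  then show "\<eta> * (1 + \<epsilon>) < 1" using eps zero_le_power2[of \<epsilon>] by linarith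
qed (use eps eta_nonneg P_nonneg in auto)

text \<open>Mirror image of the preceding argument: next to an unknown output, the right neighbour
  can be \<alpha> only by an error.\<close>

lemma forgets_shift_type_reflected:
  assumes f: "\<And>x y. f x y = (if x \<noteq> \<alpha> \<and> y = \<alpha> then \<alpha> else \<not> \<alpha>)"
  shows forgets
proof (rule forgetsI_contraction[of "\<lambda>t. P t [None] + P t [None, Some \<alpha>]" "\<eta> * (1 + \<epsilon>)"])
  have f': "f x y \<longleftrightarrow> (if \<alpha> then \<not> x \<and> y else \<not> x \<or> y)" for x y
    using f[of x y] by auto
  fix t
  have "P (Suc t) [None] \<le> E (Suc (Suc 0)) t (\<lambda>w. \<eta> * (of_bool (tl w = [None]) + of_bool (w = [None, Some \<alpha>])))"
    unfolding P_Suc length_Cons list.size(3)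
  proof (rule E_mono)
    fix w :: "bool option list" assume "length w = Suc (Suc 0)"
    then show "step (\<lambda>w. of_bool (w = [None])) w \<le> \<eta> * (of_bool (tl w = [None]) + of_bool (w = [None, Some \<alpha>]))"
      using eta_nonneg by (cases \<alpha>; auto simp: length_Suc_conv step_indicator transition_def lift_rule_def f' of_bool_def split: option.splits if_splits)
  qed
  then have 1: "P (Suc t) [None] \<le> \<eta> * (P t [None] + P t [None, Some \<alpha>])" by (simp add: P_simps)
  have "P (Suc t) [None, Some \<alpha>] \<le> E (Suc (Suc (Suc 0))) t (\<lambda>w. \<epsilon> * step (\<lambda>w. of_bool (w = [None])) (butlast w))"
    unfolding P_Suc length_Cons list.size(3)
  proof (rule E_mono)
    fix w :: "bool option list" assume "length w = Suc (Suc (Suc 0))"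
    then show "step (\<lambda>w. of_bool (w = [None, Some \<alpha>])) w \<le> \<epsilon> * step (\<lambda>w. of_bool (w = [None])) (butlast w)"
      using eps eta_nonneg
      by (cases \<alpha>; auto simp: length_Suc_conv step_indicator transition_def lift_rule_def f' of_bool_def split: option.splits if_splits)
  qed
  then have "P (Suc t) [None, Some \<alpha>] \<le> \<epsilon> * P (Suc t) [None]" by (simp add: P_simps)
  then have "P (Suc t) [None] + P (Suc t) [None, Some \<alpha>] \<le> (1 + \<epsilon>) * P (Suc t) [None]"
    by (simp add: algebra_simps)
  also have "\<dots> \<le> (1 + \<epsilon>) * (\<eta> * (P t [None] + P t [None, Some \<alpha>]))"
    using 1 eps by (intro mult_left_mono) auto
  finally show "P (Suc t) [None] + P (Suc t) [None, Some \<alpha>] \<le> \<eta> * (1 + \<epsilon>) * (P t [None] + P t [None, Some \<alpha>])"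
    by (simp add: mult_ac)
next
  have "\<eta> * (1 + \<epsilon>) = 1 - \<epsilon> - 2 * \<epsilon>\<^sup>2"
    by (simp add: \<eta>_def power2_eq_square algebra_simps)
  then show "\<eta> * (1 + \<epsilon>) < 1" using eps zero_le_power2[of \<epsilon>] by linarith
qed (use eps eta_nonneg P_nonneg in auto)

text \<open>Without errors the right end of a stretch of unknown cells runs through the states
  \<open>?\<beta>\<close>, \<open>?\<not>\<beta>\<close> alternately and retreats every other step, and the left end advances every other step.
  The weights in \<open>V\<close> below compensate for the current phase of either end.\<close>

lemma forgets_nand_type:
  assumes f: "\<And>x y. f x y = (if x = \<beta> \<and> y = \<beta> then \<not> \<beta> else \<beta>)"
  shows forgets
proof -
  have f': "f x y \<longleftrightarrow> (if \<beta> then \<not> (x \<and> y) else \<not> (x \<or> y))" for x y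
    using f[of x y] by auto
  \<comment> \<open>\<open>Z\<close>, \<open>R1\<close>, \<open>R2\<close> describe the right end of
    an unknown stretch; \<open>Y\<close>, \<open>L1\<close>, \<open>L2\<close> are their mirror
    images.\<close>
  define Q where "Q t = P t [None]" for t
  define Z where "Z t = P t [None, Some (\<not> \<beta>)]" for t
  define Y where "Y t = P t [Some (\<not> \<beta>), None]" for t
  define R1 where "R1 t = P t [None, Some \<beta>]" for t
  define R2 where "R2 t = P t [None, Some \<beta>, Some (\<not> \<beta>)]" for t
  define L1 where "L1 t = P t [Some \<beta>, None]" for t
  define L2 where "L2 t = P t [Some (\<not> \<beta>), Some \<beta>, None]" for t
  note defs = Q_def Z_def Y_def R1_def R2_def L1_def L2_def
  have nonneg: "0 \<le> Q t" "0 \<le> Z t" "0 \<le> Y t" "0 \<le> R1 t" "0 \<le> R2 t" "0 \<le> L1 t" "0 \<le> L2 t" for t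
    by (simp_all add: defs P_nonneg)
  \<comment> \<open>unknown stretches have as many left ends as right ends\<close>
  have bal: "R1 t + Z t = L1 t + Y t" for t
  proof -
    have "E (Suc (Suc 0)) t (\<lambda>w. (of_bool (w = [None, Some \<beta>]) + of_bool (w = [None, Some (\<not> \<beta>)])) + of_bool (tl w = [None]))
      = E (Suc (Suc 0)) t (\<lambda>w. (of_bool (w = [Some \<beta>, None]) + of_bool (w = [Some (\<not> \<beta>), None])) + of_bool (butlast w = [None]))"
      by (rule E_cong) (cases \<beta>; auto simp: length_Suc_conv)
    then show ?thesis by (simp add: P_simps defs)
  qed
  \<comment> \<open>An exact output is unknown for the inputs \<open>??\<close>,
    \<open>?\<beta>\<close> and \<open>\<beta>?\<close>. The first two are all pairs beginning with
    \<open>?\<close> except \<open>?\<not>\<beta>\<close>.\<close>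
  have Q': "Q (Suc t) \<le> \<eta> * (Q t + - 1 * Z t + L1 t)" for t
  proof -
  have "P (Suc t) [None] \<le> E (Suc (Suc 0)) t (\<lambda>w. \<eta> * (of_bool (butlast w = [None]) + - 1 * of_bool (w = [None, Some (\<not> \<beta>)]) + of_bool (w = [Some \<beta>, None])))"
    unfolding P_Suc length_Cons list.size(3)
  proof (rule E_mono)
    fix w :: "bool option list" assume "length w = Suc (Suc 0)"
    then show "step (\<lambda>w. of_bool (w = [None])) w \<le> \<eta> * (of_bool (butlast w = [None]) + - 1 * of_bool (w = [None, Some (\<not> \<beta>)]) + of_bool (w = [Some \<beta>, None]))"
      using eps eta_nonneg
      by (cases \<beta>; auto simp: length_Suc_conv step_indicator transition_def lift_rule_def f' of_bool_def
          power2_eq_square algebra_simps split: option.splits if_splits)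
  qed
    then show ?thesis by (simp only: P_simps defs)
  qed
  \<comment> \<open>Either \<beta> is an overwriting, or both outputs are exact. Then the unknown
    left output excludes \<not>\<beta> as middle input, so the right input is \<not>\<beta>; a
    middle \<open>?\<close> leads to \<open>Z\<close>, a middle \<beta> to
    \<open>R2\<close>.\<close>
  have R1': "R1 (Suc t) \<le> \<epsilon> * Q (Suc t) + \<eta>\<^sup>2 * (Z t + R2 t)" for t
  proof -
  have "P (Suc t) [None, Some \<beta>] \<le> E (Suc (Suc (Suc 0))) t (\<lambda>w. \<epsilon> * step (\<lambda>w. of_bool (w = [None])) (butlast w) + \<eta>\<^sup>2 * (of_bool (tl w = [None, Some (\<not> \<beta>)]) + of_bool (w = [None, Some \<beta>, Some (\<not> \<beta>)])))"
    unfolding P_Suc length_Cons list.size(3)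
  proof (rule E_mono)
    fix w :: "bool option list" assume "length w = Suc (Suc (Suc 0))"
    then show "step (\<lambda>w. of_bool (w = [None, Some \<beta>])) w \<le> \<epsilon> * step (\<lambda>w. of_bool (w = [None])) (butlast w) + \<eta>\<^sup>2 * (of_bool (tl w = [None, Some (\<not> \<beta>)]) + of_bool (w = [None, Some \<beta>, Some (\<not> \<beta>)]))"
      using eps eta_nonneg
      by (cases \<beta>; auto simp: length_Suc_conv step_indicator transition_def lift_rule_def f' of_bool_def
          power2_eq_square algebra_simps split: option.splits if_splits)
  qed
    then show ?thesis by (simp only: P_simps defs)
  qed
  have L1': "L1 (Suc t) \<le> \<epsilon> * Q (Suc t) + \<eta>\<^sup>2 * (Y t + L2 t)" for t
  proof -
  have "P (Suc t) [Some \<beta>, None] \<le> E (Suc (Suc (Suc 0))) t (\<lambda>w. \<epsilon> * step (\<lambda>w. of_bool (w = [None])) (tl w) + \<eta>\<^sup>2 * (of_bool (butlast w = [Some (\<not> \<beta>), None]) + of_bool (w = [Some (\<not> \<beta>), Some \<beta>, None])))"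
    unfolding P_Suc length_Cons list.size(3)
  proof (rule E_mono)
    fix w :: "bool option list" assume "length w = Suc (Suc (Suc 0))"
    then show "step (\<lambda>w. of_bool (w = [Some \<beta>, None])) w \<le> \<epsilon> * step (\<lambda>w. of_bool (w = [None])) (tl w) + \<eta>\<^sup>2 * (of_bool (butlast w = [Some (\<not> \<beta>), None]) + of_bool (w = [Some (\<not> \<beta>), Some \<beta>, None]))"
      using eps eta_nonneg
      by (cases \<beta>; auto simp: length_Suc_conv step_indicator transition_def lift_rule_def f' of_bool_def
          power2_eq_square algebra_simps split: option.splits if_splits)
  qed
    then show ?thesis by (simp only: P_simps defs)
  qed
  \<comment> \<open>If \<not>\<beta> is an exact output, both its inputs are \<beta>. An exact
    \<beta> before it would need \<not>\<beta> as left input, making the first output known; so the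
    middle cell is an overwriting.\<close>
  have R2': "R2 (Suc t) \<le> \<epsilon> * R1 (Suc t) + \<epsilon> * (\<eta> * Q (Suc t))" for t
  proof -
  have "P (Suc t) [None, Some \<beta>, Some (\<not> \<beta>)] \<le> E (Suc (Suc (Suc (Suc 0)))) t (\<lambda>w. \<epsilon> * step (\<lambda>w. of_bool (w = [None, Some \<beta>])) (butlast w) + \<epsilon> * (\<eta> * step (\<lambda>w. of_bool (w = [None])) (butlast (butlast w))))"
    unfolding P_Suc length_Cons list.size(3)
  proof (rule E_mono)
    fix w :: "bool option list" assume "length w = Suc (Suc (Suc (Suc 0)))"
    then show "step (\<lambda>w. of_bool (w = [None, Some \<beta>, Some (\<not> \<beta>)])) w \<le> \<epsilon> * step (\<lambda>w. of_bool (w = [None, Some \<beta>])) (butlast w) + \<epsilon> * (\<eta> * step (\<lambda>w. of_bool (w = [None])) (butlast (butlast w)))"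
      using eps eta_nonneg
      by (cases \<beta>; auto simp: length_Suc_conv step_indicator transition_def lift_rule_def f' of_bool_def
          power2_eq_square algebra_simps split: option.splits if_splits)
  qed
    then show ?thesis by (simp only: P_simps defs)
  qed
  have L2': "L2 (Suc t) \<le> \<epsilon> * L1 (Suc t) + \<epsilon> * (\<eta> * Q (Suc t))" for t
  proof -
  have "P (Suc t) [Some (\<not> \<beta>), Some \<beta>, None] \<le> E (Suc (Suc (Suc (Suc 0)))) t (\<lambda>w. \<epsilon> * step (\<lambda>w. of_bool (w = [Some \<beta>, None])) (tl w) + \<epsilon> * (\<eta> * step (\<lambda>w. of_bool (w = [None])) (tl (tl w))))"
    unfolding P_Suc length_Cons list.size(3)
  proof (rule E_mono)
    fix w :: "bool option list" assume "length w = Suc (Suc (Suc (Suc 0)))"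
    then show "step (\<lambda>w. of_bool (w = [Some (\<not> \<beta>), Some \<beta>, None])) w \<le> \<epsilon> * step (\<lambda>w. of_bool (w = [Some \<beta>, None])) (tl w) + \<epsilon> * (\<eta> * step (\<lambda>w. of_bool (w = [None])) (tl (tl w)))"
      using eps eta_nonneg
      by (cases \<beta>; auto simp: length_Suc_conv step_indicator transition_def lift_rule_def f' of_bool_def
          power2_eq_square algebra_simps split: option.splits if_splits)
  qed
    then show ?thesis by (simp only: P_simps defs)
  qed
  \<comment> \<open>The weights 1/2 make the terms in \<open>Z\<close> and \<open>Y\<close> cancel
    in the estimate of \<open>V (Suc t)\<close>. \<open>A\<close> is the coefficient of
    \<open>Q (Suc t)\<close> that arises there, and \<rho> is a simpler bound for the resulting
    factor \<open>\<eta> * A\<close>.\<close>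
  define V where "V t = Q t + (R1 t + R2 t + L1 t + L2 t) / 2" for t
  define A where "A = 1 + 2 * \<epsilon> - \<epsilon>\<^sup>2"
  define \<rho> where "\<rho> = 1 - 4 * \<epsilon>\<^sup>2"
  have "\<epsilon> * \<epsilon> \<le> \<epsilon> * (1/2)" using eps by (intro mult_left_mono) auto
  then have e2: "\<epsilon>\<^sup>2 \<le> \<epsilon> / 2" "0 < \<epsilon>\<^sup>2" using eps by (simp_all add: power2_eq_square)
  have A0: "0 \<le> A" using e2 eps by (simp add: A_def)
  have "\<eta> * (1 + \<epsilon>) = 1 - \<epsilon> - 2 * \<epsilon>\<^sup>2"
    by (simp add: \<eta>_def power2_eq_square algebra_simps)
  then have c0: "\<eta> * (1 + \<epsilon>) \<le> A" using e2 eps by (simp add: A_def)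
  have c1: "(1 + \<epsilon>) * \<eta>\<^sup>2 \<le> \<eta> * A"
    using mult_left_mono[OF c0 eta_nonneg] by (simp add: power2_eq_square mult_ac)
  have "\<rho> - \<eta> * A = \<epsilon>\<^sup>2 * \<eta>"
    by (simp add: \<rho>_def \<eta>_def A_def power2_eq_square algebra_simps)
  then have c2: "\<eta> * A \<le> \<rho>" using mult_nonneg_nonneg[OF zero_le_power2[of \<epsilon>] eta_nonneg] by linarith
  show ?thesis
  proof (rule forgetsI_contraction[of V \<rho>])
    fix t
    show "P t [None] \<le> V t" using nonneg[of t] by (simp add: V_def Q_def)
    have "V (Suc t) \<le> (1 + \<epsilon> * \<eta>) * Q (Suc t) + (1 + \<epsilon>) / 2 * (R1 (Suc t) + L1 (Suc t))"
      using R2'[of t] L2'[of t] by (simp add: V_def field_simps)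
    also have "\<dots> \<le> (1 + \<epsilon> * \<eta>) * Q (Suc t) + (1 + \<epsilon>) / 2 * (2 * \<epsilon> * Q (Suc t) + \<eta>\<^sup>2 * (Z t + R2 t + Y t + L2 t))"
      using R1'[of t] L1'[of t] eps by (intro add_left_mono mult_left_mono) (auto simp: algebra_simps)
    also have "\<dots> = A * Q (Suc t) + (1 + \<epsilon>) * \<eta>\<^sup>2 * ((Z t + Y t) / 2 + (R2 t + L2 t) / 2)"
      by (simp add: A_def \<eta>_def power2_eq_square field_simps)
    also have "\<dots> \<le> A * (\<eta> * (Q t + (R1 t + L1 t) / 2 - (Z t + Y t) / 2)) + \<eta> * A * ((Z t + Y t) / 2 + (R2 t + L2 t) / 2)"
    proof (intro add_mono mult_left_mono mult_right_mono c1 A0)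
      \<comment> \<open>By \<open>bal\<close>, \<open>L1 t - Z t\<close> equals
        \<open>R1 t - Y t\<close>, hence also the mean of the two.\<close>
      have "Q t + - 1 * Z t + L1 t = Q t + (R1 t + L1 t) / 2 - (Z t + Y t) / 2"
        using bal[of t] by (simp add: field_simps)
      then show "Q (Suc t) \<le> \<eta> * (Q t + (R1 t + L1 t) / 2 - (Z t + Y t) / 2)"
        using Q'[of t] by metis
    qed (use nonneg[of t] in auto)
    also have "\<dots> = \<eta> * A * V t" by (simp add: V_def field_simps)
    also have "\<dots> \<le> \<rho> * V t"
      using nonneg[of t] by (intro mult_right_mono c2) (simp add: V_def)
    finally show "V (Suc t) \<le> \<rho> * V t" .
  next
    show "\<rho> < 1" using e2 by (simp add: \<rho>_def)
    show "0 \<le> \<rho>" using mult_nonneg_nonneg[OF eta_nonneg A0] c2 by linarith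
  qed
qed

section \<open>Duality for AND and OR\<close>

text \<open>Test functions of the duality: the marks in the first list pick out a finite set of
  cells. Cells beyond the end of either list impose no condition.\<close>

fun monomial :: "bool \<Rightarrow> bool list \<Rightarrow> bool option list \<Rightarrow> real" where
  "monomial \<beta> (m # ms) (a # w) = (if m then of_bool (a = Some \<beta>) else 1) * monomial \<beta> ms w"
| "monomial \<beta> _ _ = 1"

definition eval_comb :: "bool \<Rightarrow> (real \<times> bool list) list \<Rightarrow> bool option list \<Rightarrow> real" where
  "eval_comb \<beta> cs w = (\<Sum>(c, m)\<leftarrow>cs. c * monomial \<beta> m w)"

lemma eval_comb_simps [simp]:
  "eval_comb \<beta> [] w = 0"
  "eval_comb \<beta> ((c, m) # cs) w = c * monomial \<beta> m w + eval_comb \<beta> cs w"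
  "eval_comb \<beta> (cs @ ds) w = eval_comb \<beta> cs w + eval_comb \<beta> ds w"
  by (simp_all add: eval_comb_def)

lemma eval_comb_map:
  assumes "\<And>c m. (c, m) \<in> set cs \<Longrightarrow> monomial \<beta> (F m) w = x * monomial \<beta> m w'"
  shows "eval_comb \<beta> (map (\<lambda>(c, m). (d * c, F m)) cs) w = d * x * eval_comb \<beta> cs w'"
  using assms
proof (induction cs)
  case (Cons p cs)
  obtain a b where p: "p = (a, b)" by force
  have "eval_comb \<beta> (map (\<lambda>(c, m). (d * c, F m)) cs) w = d * x * eval_comb \<beta> cs w'"
    using Cons.prems by (intro Cons.IH) auto
  moreover have "monomial \<beta> (F b) w = x * monomial \<beta> b w'" using Cons.prems[of a b] p by simp
  ultimately show ?case by (simp add: p distrib_left)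
qed simp

text \<open>Expand in the first cell: the value at \<not>\<beta>, plus the indicator of \<beta>
  times the difference of the two values. Iteration gives an inclusion-exclusion formula whose
  coefficients may be negative.\<close>

lemma words_spanned_by_monomials:
  "\<exists>cs. (\<forall>(c, m) \<in> set cs. length m = n) \<and> (\<forall>v. length v = n \<longrightarrow> g (map Some v) = eval_comb \<beta> cs (map Some v))"
proof (induction n arbitrary: g)
  case 0
  show ?case by (rule exI[of _ "[(g [], [])]"]) simp
next
  case (Suc n)
  obtain cs where cs: "\<forall>(c, m) \<in> set cs. length m = n"
    "\<And>v. length v = n \<Longrightarrow> g (Some (\<not> \<beta>) # map Some v) = eval_comb \<beta> cs (map Some v)"
    using Suc[of "\<lambda>w. g (Some (\<not> \<beta>) # w)"] by auto
  obtain ds where ds: "\<forall>(c, m) \<in> set ds. length m = n"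
    "\<And>v. length v = n \<Longrightarrow> g (Some \<beta> # map Some v) - g (Some (\<not> \<beta>) # map Some v) = eval_comb \<beta> ds (map Some v)"
    using Suc[of "\<lambda>w. g (Some \<beta> # w) - g (Some (\<not> \<beta>) # w)"] by auto
  define es where "es = map (\<lambda>(c, m). (1 * c, False # m)) cs @ map (\<lambda>(c, m). (1 * c, True # m)) ds"
  show ?case
  proof (intro exI[of _ es] conjI allI impI)
    show "\<forall>(c, m) \<in> set es. length m = Suc n" using cs(1) ds(1) by (auto simp: es_def)
    fix v :: "bool list" assume "length v = Suc n"
    then obtain a v' where v: "v = a # v'" "length v' = n" by (auto simp: length_Suc_conv)
    have "eval_comb \<beta> es (map Some v) = eval_comb \<beta> cs (map Some v') + of_bool (a = \<beta>) * eval_comb \<beta> ds (map Some v')"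
      unfolding es_def v list.map eval_comb_simps
      by (subst eval_comb_map[where x=1 and w'="map Some v'"], simp,
          subst eval_comb_map[where x="of_bool (a = \<beta>)" and w'="map Some v'"], simp_all)
    also have "\<dots> = g (map Some v)"
      using cs(2)[OF v(2)] ds(2)[OF v(2)] v(1) by (cases "a = \<beta>") auto
    finally show "g (map Some v) = eval_comb \<beta> es (map Some v)" ..
  qed
qed

text \<open>The constant \<open>d\<close> collects the outcomes in which every marked cell is overwritten with
  \<open>\<beta>\<close>; overwriting a marked cell with \<open>\<not>\<beta>\<close> kills the monomial, whence the factor \<open>1 - \<epsilon>\<close>.\<close>

lemma step_monomial:
  assumes f: "\<And>x y. f x y = (if x = \<beta> \<and> y = \<beta> then \<beta> else \<not> \<beta>)"
  shows "\<exists>d cs. 0 \<le> d \<and> (\<forall>(c, m') \<in> set cs. 0 \<le> c \<and> length m' = Suc (length m)) \<and>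
    d + sum_list (map fst cs) \<le> 1 \<and> (True \<in> set m \<longrightarrow> sum_list (map fst cs) \<le> 1 - \<epsilon>) \<and>
    (\<forall>v. length v = Suc (length m) \<longrightarrow>
      step (monomial \<beta> m) (map Some v) = d + eval_comb \<beta> cs (map Some v))"
proof (induction m)
  case Nil
  show ?case by (rule exI[of _ 1], rule exI[of _ "[]"]) (auto simp: length_Suc_conv)
next
  case (Cons b m)
  then obtain d cs where d: "0 \<le> d" and cs: "\<And>c m'. (c, m') \<in> set cs \<Longrightarrow> 0 \<le> c \<and> length m' = Suc (length m)"
    and sum: "d + sum_list (map fst cs) \<le> 1" "True \<in> set m \<Longrightarrow> sum_list (map fst cs) \<le> 1 - \<epsilon>"
    and eq: "\<And>v. length v = Suc (length m) \<Longrightarrow> step (monomial \<beta> m) (map Some v) = d + eval_comb \<beta> cs (map Some v)"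
    by fast
  have sum_map: "sum_list (map fst (map (\<lambda>(c, m). (x * c, F m)) cs)) = x * sum_list (map fst cs)"
    for x :: real and F :: "bool list \<Rightarrow> bool list"
    by (induction cs) (auto simp: algebra_simps)
  have cs0: "0 \<le> sum_list (map fst cs)" using cs by (intro sum_list_nonneg) auto
  show ?case
  proof (cases b)
    case False
    define es where "es = map (\<lambda>(c, m). (1 * c, False # m)) cs"
    show ?thesis
    proof (intro exI[of _ d] exI[of _ es] conjI allI impI)
      show "\<forall>(c, m') \<in> set es. 0 \<le> c \<and> length m' = Suc (length (b # m))" using cs by (auto simp: es_def)
      show "d + sum_list (map fst es) \<le> 1" using sum(1) unfolding es_def sum_map by simp
      show "sum_list (map fst es) \<le> 1 - \<epsilon>" if "True \<in> set (b # m)"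
        using sum(2) that False unfolding es_def sum_map by simp
      fix v :: "bool list" assume "length v = Suc (length (b # m))"
      then obtain x y v' where v: "v = x # y # v'" "length v' = length m" by (auto simp: length_Suc_conv)
      have "step (monomial \<beta> (b # m)) (map Some v) = step (monomial \<beta> m) (map Some (y # v'))"
        using False v(1) by (simp add: weights_sum)
      also have "\<dots> = d + eval_comb \<beta> cs (map Some (y # v'))" by (rule eq) (simp add: v)
      also have "eval_comb \<beta> cs (map Some (y # v')) = eval_comb \<beta> es (map Some v)"
        unfolding es_def by (subst eval_comb_map[where x=1 and w'="map Some (y # v')"]) (auto simp: v)
      finally show "step (monomial \<beta> (b # m)) (map Some v) = d + eval_comb \<beta> es (map Some v)" .
    qed (fact d)
  next
    case True
    \<comment> \<open>Overwriting with \<beta> leaves only the condition on the rest. An exact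
      update gives \<beta> exactly when both inputs are \<beta>; the second input is then marked in
      any case, so \<open>tl m\<close> discards its old mark. The middle term is the exact update
      applied to the constant \<open>d\<close>.\<close>
    define es where "es = map (\<lambda>(c, m). (\<epsilon> * c, False # m)) cs @ (\<eta> * d, True # True # replicate (length m) False) #
      map (\<lambda>(c, m). (\<eta> * c, True # True # tl m)) cs"
    have tot: "sum_list (map fst es) = (\<epsilon> + \<eta>) * sum_list (map fst cs) + \<eta> * d"
      unfolding es_def map_append list.map sum_list.append sum_list.Cons sum_map by (simp add: algebra_simps)
    also have "\<dots> = (1 - \<epsilon>) * (d + sum_list (map fst cs)) - \<epsilon> * d"
      by (simp add: \<eta>_def algebra_simps)
    finally have tot: "sum_list (map fst es) = (1 - \<epsilon>) * (d + sum_list (map fst cs)) - \<epsilon> * d" .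
    have "(1 - \<epsilon>) * (d + sum_list (map fst cs)) \<le> (1 - \<epsilon>) * 1"
      using sum(1) eps by (intro mult_left_mono) auto
    then have le: "sum_list (map fst es) + \<epsilon> * d \<le> 1 - \<epsilon>" using tot by simp
    have ed: "0 \<le> \<epsilon> * d" using d eps by simp
    show ?thesis
    proof (intro exI[of _ "\<epsilon> * d"] exI[of _ es] conjI allI impI)
      show "\<forall>(c, m') \<in> set es. 0 \<le> c \<and> length m' = Suc (length (b # m))"
        using cs eps eta_nonneg d by (auto simp: es_def)
      show "\<epsilon> * d + sum_list (map fst es) \<le> 1" "sum_list (map fst es) \<le> 1 - \<epsilon>"
        using le ed eps by auto
      fix v :: "bool list" assume "length v = Suc (length (b # m))"
      then obtain x y v' where v: "v = x # y # v'" "length v' = length m" by (auto simp: length_Suc_conv)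
      define w where "w = map Some (y # v')"
      have one: "step (\<lambda>w. monomial \<beta> (b # m) (c # w)) w = of_bool (c = Some \<beta>) * step (monomial \<beta> m) w" for c
        using True step_cmult[of "of_bool (c = Some \<beta>)" "monomial \<beta> m" w] by simp
      have "step (monomial \<beta> (b # m)) (map Some v) = (\<epsilon> + \<eta> * of_bool (x = \<beta> \<and> y = \<beta>)) * step (monomial \<beta> m) w"
        using v(1) one by (cases \<beta>) (auto simp: w_def f algebra_simps)
      also have "step (monomial \<beta> m) w = d + eval_comb \<beta> cs w"
        unfolding w_def by (rule eq) (simp add: v)
      also have "(\<epsilon> + \<eta> * of_bool (x = \<beta> \<and> y = \<beta>)) * (d + eval_comb \<beta> cs w) = \<epsilon> * d + eval_comb \<beta> es (map Some v)"
      proof -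
        have 1: "eval_comb \<beta> (map (\<lambda>(c, m). (\<epsilon> * c, False # m)) cs) (map Some v) = \<epsilon> * 1 * eval_comb \<beta> cs w"
          by (rule eval_comb_map) (simp add: v w_def)
        have 2: "eval_comb \<beta> (map (\<lambda>(c, m). (\<eta> * c, True # True # tl m)) cs) (map Some v)
            = \<eta> * of_bool (x = \<beta> \<and> y = \<beta>) * eval_comb \<beta> cs w"
        proof (rule eval_comb_map)
          fix c m' assume "(c, m') \<in> set cs"
          then have "length m' = Suc (length m)" using cs by blast
          then obtain a m1 where "m' = a # m1" by (cases m') auto
          then show "monomial \<beta> (True # True # tl m') (map Some v) = of_bool (x = \<beta> \<and> y = \<beta>) * monomial \<beta> m' w"
            by (auto simp: v w_def)
        qed
        have 3: "monomial \<beta> (replicate n False) u = 1" for n u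
          by (induction n arbitrary: u) (simp, case_tac u, simp_all)
        show ?thesis unfolding es_def eval_comb_simps 1 2 by (auto simp: v 3 algebra_simps)
      qed
      finally show "step (monomial \<beta> (b # m)) (map Some v) = \<epsilon> * d + eval_comb \<beta> es (map Some v)" .
    qed (fact ed)
  qed
qed

lemma funpow_step_comb:
  "(step ^^ t) (eval_comb \<beta> cs) v = (\<Sum>(c, m)\<leftarrow>cs. c * (step ^^ t) (monomial \<beta> m) v)"
proof (induction cs)
  case Nil
  have "eval_comb \<beta> [] = (\<lambda>_. 0)" by auto
  then show ?case by simp
next
  case (Cons p cs)
  obtain c m where p: "p = (c, m)" by force
  have "eval_comb \<beta> (p # cs) = (\<lambda>w. c * monomial \<beta> m w + eval_comb \<beta> cs w)" by (auto simp: p)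
  then show ?case using Cons by (simp add: p funpow_step_add funpow_step_cmult)
qed

text \<open>Known inputs have known outputs, so identities valid only on known words, such as that
  of \<open>step_monomial\<close>, survive iteration.\<close>

lemma step_cong_known:
  assumes "\<And>v. length v = n \<Longrightarrow> g (map Some v) = h (map Some v)" "length v = Suc n"
  shows "step g (map Some v) = step h (map Some v)"
  using assms
proof (induction v arbitrary: g h n rule: induct_list012)
  case (3 a b v)
  have "step (\<lambda>w. g (Some c # w)) (map Some (b # v)) = step (\<lambda>w. h (Some c # w)) (map Some (b # v))" for c
    by (rule "3.IH"(2)[of "length v"]) (use "3.prems" "3.prems"(1)[of "c # v" for v] in auto)
  then show ?case by simp
qed auto

lemma funpow_step_cong_known:
  assumes "\<And>v. length v = n \<Longrightarrow> g (map Some v) = h (map Some v)" "length v = n + t"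
  shows "(step ^^ t) g (map Some v) = (step ^^ t) h (map Some v)"
  using assms(2)
proof (induction t arbitrary: v)
  case (Suc t)
  then show ?case using step_cong_known[of "n + t" "(step ^^ t) g" "(step ^^ t) h" v] by simp
qed (use assms(1) in simp)

lemma monomial_bounds: "0 \<le> monomial \<beta> m w \<and> monomial \<beta> m w \<le> 1"
  by (induction \<beta> m w rule: monomial.induct) (auto simp: mult_le_one)

lemma abs_sum_list_diff_le:
  fixes F G :: "'a \<Rightarrow> real"
  assumes "\<And>c m. (c, m) \<in> set cs \<Longrightarrow> \<bar>F m - G m\<bar> \<le> B"
  shows "\<bar>(\<Sum>(c, m)\<leftarrow>cs. c * F m) - (\<Sum>(c, m)\<leftarrow>cs. c * G m)\<bar> \<le> (\<Sum>(c, m)\<leftarrow>cs. \<bar>c\<bar>) * B"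
  using assms
proof (induction cs)
  case (Cons p cs)
  obtain c m where p: "p = (c, m)" by force
  have "\<bar>c * F m - c * G m\<bar> \<le> \<bar>c\<bar> * B"
    using Cons.prems[of c m] by (simp add: p abs_mult mult_left_mono flip: right_diff_distrib)
  moreover have "\<bar>(\<Sum>(c, m)\<leftarrow>cs. c * F m) - (\<Sum>(c, m)\<leftarrow>cs. c * G m)\<bar> \<le> (\<Sum>(c, m)\<leftarrow>cs. \<bar>c\<bar>) * B"
    using Cons by auto
  ultimately show ?case by (simp add: p ring_distribs)
qed simp

text \<open>One \<open>step\<close> turns a monomial with a mark into a constant, which cancels in
  the difference, plus a nonnegative combination of total weight at most 1 - \<epsilon>. A monomial
  without marks is constant.\<close>

lemma monomial_oscillation:
  assumes f: "\<And>x y. f x y = (if x = \<beta> \<and> y = \<beta> then \<beta> else \<not> \<beta>)"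
    and "length v = length m + t" "length v' = length m + t"
  shows "\<bar>(step ^^ t) (monomial \<beta> m) (map Some v) - (step ^^ t) (monomial \<beta> m) (map Some v')\<bar> \<le> (1 - \<epsilon>) ^ t"
  using assms(2-)
proof (induction t arbitrary: m v v')
  case 0
  then show ?case
    using monomial_bounds[of \<beta> m "map Some v"] monomial_bounds[of \<beta> m "map Some v'"] by (simp add: abs_le_iff)
next
  case (Suc t)
  show ?case
  proof (cases "True \<in> set m")
    case False
    then have "monomial \<beta> m w = 1" for w
      by (induction \<beta> m w rule: monomial.induct) auto
    then have "monomial \<beta> m = (\<lambda>_. 1)" by auto
    then show ?thesis using eps by simp
  next
    case True
    obtain d cs where cs: "\<forall>(c, m') \<in> set cs. 0 \<le> c \<and> length m' = Suc (length m)"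
      and sum: "sum_list (map fst cs) \<le> 1 - \<epsilon>"
      and eq: "\<And>v. length v = Suc (length m) \<Longrightarrow> step (monomial \<beta> m) (map Some v) = d + eval_comb \<beta> cs (map Some v)"
      using step_monomial[OF f, of m] True by blast
    have *: "(step ^^ Suc t) (monomial \<beta> m) (map Some v) = d + (\<Sum>(c, m)\<leftarrow>cs. c * (step ^^ t) (monomial \<beta> m) (map Some v))"
      if "length v = length m + Suc t" for v
    proof -
      have "(step ^^ Suc t) (monomial \<beta> m) (map Some v) = (step ^^ t) (step (monomial \<beta> m)) (map Some v)"
        by (simp only: funpow_Suc_right o_apply)
      also have "\<dots> = (step ^^ t) (\<lambda>w. d + eval_comb \<beta> cs w) (map Some v)"
        by (rule funpow_step_cong_known[where n="Suc (length m)"]) (use eq that in auto)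
      also have "\<dots> = d + (step ^^ t) (eval_comb \<beta> cs) (map Some v)"
        by (simp add: funpow_step_add)
      finally show ?thesis by (simp add: funpow_step_comb)
    qed
    have "\<bar>(\<Sum>(c, m)\<leftarrow>cs. c * (step ^^ t) (monomial \<beta> m) (map Some v))
        - (\<Sum>(c, m)\<leftarrow>cs. c * (step ^^ t) (monomial \<beta> m) (map Some v'))\<bar> \<le> (\<Sum>(c, m)\<leftarrow>cs. \<bar>c\<bar>) * (1 - \<epsilon>) ^ t"
      by (rule abs_sum_list_diff_le) (use Suc cs in auto)
    also have "(\<Sum>(c, m)\<leftarrow>cs. \<bar>c\<bar>) = sum_list (map fst cs)"
      using cs by (intro arg_cong[of _ _ sum_list] map_cong) auto
    also have "\<dots> * (1 - \<epsilon>) ^ t \<le> (1 - \<epsilon>) * (1 - \<epsilon>) ^ t"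
      using sum eps by (intro mult_right_mono) auto
    finally show ?thesis unfolding *[OF Suc.prems(1)] *[OF Suc.prems(2)] by simp
  qed
qed

lemma forgets_and_type:
  assumes f: "\<And>x y. f x y = (if x = \<beta> \<and> y = \<beta> then \<beta> else \<not> \<beta>)"
  shows forgets
  unfolding forgets_def
proof (intro allI impI)
  fix n and g :: "bool option list \<Rightarrow> real" and e :: real assume e: "0 < e"
  obtain cs where cs: "\<forall>(c, m) \<in> set cs. length m = n"
    "\<And>v. length v = n \<Longrightarrow> g (map Some v) = eval_comb \<beta> cs (map Some v)"
    using words_spanned_by_monomials[of n g \<beta>] by blast
  \<comment> \<open>The expansion of \<open>g\<close> depends neither on \<open>t\<close> nor on the
    initial words, so its signed coefficients cost only a fixed factor.\<close>
  define C where "C = (\<Sum>(c, m)\<leftarrow>cs. \<bar>c\<bar>)"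
  have "(\<lambda>t. C * (1 - \<epsilon>) ^ t) \<longlonglongrightarrow> 0"
    using eps by (intro tendsto_mult_right_zero LIMSEQ_power_zero) auto
  then have "\<forall>\<^sub>F t in sequentially. C * (1 - \<epsilon>) ^ t < e" using e by (rule order_tendstoD(2))
  then obtain t where t: "C * (1 - \<epsilon>) ^ t < e" by (auto simp: eventually_sequentially)
  show "\<exists>t. \<forall>v v'. length v = n + t \<longrightarrow> length v' = n + t \<longrightarrow>
      \<bar>(step ^^ t) g (map Some v) - (step ^^ t) g (map Some v')\<bar> \<le> e"
  proof (intro exI allI impI)
    fix v v' :: "bool list" assume v: "length v = n + t" "length v' = n + t"
    have *: "(step ^^ t) g (map Some v) = (\<Sum>(c, m)\<leftarrow>cs. c * (step ^^ t) (monomial \<beta> m) (map Some v))"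
      if "length v = n + t" for v
      using funpow_step_cong_known[where h="eval_comb \<beta> cs", OF cs(2) that] by (simp add: funpow_step_comb)
    have "\<bar>(step ^^ t) g (map Some v) - (step ^^ t) g (map Some v')\<bar> \<le> C * (1 - \<epsilon>) ^ t"
      unfolding *[OF v(1)] *[OF v(2)] C_def
      by (rule abs_sum_list_diff_le) (use cs(1) v monomial_oscillation[OF f] in auto)
    then show "\<bar>(step ^^ t) g (map Some v) - (step ^^ t) g (map Some v')\<bar> \<le> e" using t by linarith
  qed
qed

end

section \<open>From words to measures on configurations\<close>

text \<open>Tychonoff's theorem with finite factors. Compactness yields countable additivity on
  cylinders and uniform approximation of continuous functions.\<close>

lemma compact_config: "compact (UNIV :: config set)"
proof -
  have "compact_space (product_topology (\<lambda>_::int. euclidean :: bool topology) UNIV)"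
    by (intro compact_space_product_topology[THEN iffD2] disjI2 ballI) (simp add: compact_space_def finite_imp_compact)
  then show ?thesis
    by (simp add: euclidean_product_topology compact_space_def)
qed

definition window_dependent :: "nat \<Rightarrow> (config \<Rightarrow> 'b) \<Rightarrow> bool" where
  "window_dependent n f \<longleftrightarrow> (\<forall>x y. (\<forall>i\<in>{- int n..int n}. x i = y i) \<longrightarrow> f x = f y)"

lemma window_dependentD: "window_dependent n f \<Longrightarrow> (\<And>i. i \<in> {- int n..int n} \<Longrightarrow> x i = y i) \<Longrightarrow> f x = f y"
  unfolding window_dependent_def by blast

lemma window_dependent_mono: "window_dependent n f \<Longrightarrow> n \<le> m \<Longrightarrow> window_dependent m f"
  unfolding window_dependent_def by fastforce

definition agreeing :: "nat \<Rightarrow> config \<Rightarrow> config set" where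
  "agreeing n x = {y. \<forall>i\<in>{- int n..int n}. y i = x i}"

lemma open_agreeing: "open (agreeing n x)"
  using product_topology_basis'[of "{- int n..int n}" "\<lambda>i. {x i}" "\<lambda>i. i"]
  by (simp add: agreeing_def Topological_Spaces.open_discrete)

text \<open>An algebra of clopen sets generating the Borel sets, on which the limit measure is first
  defined.\<close>

definition cylinders :: "config set set" where
  "cylinders = {A. \<exists>n. window_dependent n (\<lambda>x. x \<in> A)}"

lemma open_cylinder:
  assumes "A \<in> cylinders" shows "open A"
proof -
  obtain n where n: "window_dependent n (\<lambda>x. x \<in> A)" using assms by (auto simp: cylinders_def)
  have "y \<in> A" if "x \<in> A" "y \<in> agreeing n x" for x y
    using window_dependentD[OF n, of y x] that by (auto simp: agreeing_def)
  moreover have "x \<in> agreeing n x" for x by (simp add: agreeing_def)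
  ultimately have "A = (\<Union>x\<in>A. agreeing n x)" by blast
  then show ?thesis using open_agreeing by (metis open_UN)
qed

lemma cylinders_algebra: "algebra UNIV cylinders"
proof -
  have "a \<inter> b \<in> cylinders" if ab: "a \<in> cylinders" "b \<in> cylinders" for a b
  proof -
    obtain n m where "window_dependent n (\<lambda>x. x \<in> a)" "window_dependent m (\<lambda>x. x \<in> b)"
      using ab by (auto simp: cylinders_def)
    then have "window_dependent (max n m) (\<lambda>x. x \<in> a)" "window_dependent (max n m) (\<lambda>x. x \<in> b)"
      by (auto intro: window_dependent_mono)
    then have "window_dependent (max n m) (\<lambda>x. x \<in> a \<inter> b)" unfolding window_dependent_def by blast
    then show ?thesis by (auto simp: cylinders_def)
  qed
  moreover have "UNIV - a \<in> cylinders" if "a \<in> cylinders" for a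
    using that by (auto simp: cylinders_def window_dependent_def)
  moreover have "{} \<in> cylinders" by (auto simp: cylinders_def window_dependent_def)
  ultimately show ?thesis by (auto simp: algebra_iff_Int)
qed

lemma sigma_sets_cylinders: "sigma_sets UNIV cylinders = sets (borel :: config measure)"
proof (intro antisym subsetI)
  show "A \<in> sets borel" if "A \<in> sigma_sets UNIV cylinders" for A
    using that
  proof induction
    case (Compl a)
    then show ?case using sets.compl_sets[of a borel] by simp
  qed (auto intro: borel_open open_cylinder)
next
  have gen: "sets borel = sigma_sets (UNIV :: config set) {{x. x i \<in> A} | i A. True}"
    using sets_PiM_single[of UNIV "\<lambda>_::int. count_space (UNIV::bool set)"] by (simp add: sets_PiM_config)
  have "{x. x i \<in> A} \<in> cylinders" for i A
  proof -
    have "window_dependent (nat \<bar>i\<bar>) (\<lambda>x. x \<in> {x. x i \<in> A})"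
      unfolding window_dependent_def
    proof (intro allI impI)
      fix x y :: config assume "\<forall>j\<in>{- int (nat \<bar>i\<bar>)..int (nat \<bar>i\<bar>)}. x j = y j"
      then have "x i = y i" by (rule bspec) auto
      then show "(x \<in> {x. x i \<in> A}) = (y \<in> {x. x i \<in> A})" by simp
    qed
    then show ?thesis by (auto simp: cylinders_def)
  qed
  then have "sigma_sets (UNIV :: config set) {{x. x i \<in> A} | i A. True} \<subseteq> sigma_sets UNIV cylinders"
    by (intro sigma_sets_mono') auto
  then show "A \<in> sigma_sets UNIV cylinders" if "A \<in> sets borel" for A
    using that gen by auto
qed

lemma cylinder_borel: "A \<in> cylinders \<Longrightarrow> A \<in> sets borel"
  by (rule borel_open[OF open_cylinder])

text \<open>The complements form an open cover of a compact space, so finitely many suffice. Hence a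
  finitely additive function on cylinders is continuous at the empty set.\<close>

lemma decseq_cylinders_empty:
  assumes "range A \<subseteq> cylinders" "decseq A" "(\<Inter>i. A i) = {}"
  shows "\<exists>N. \<forall>n\<ge>N. A n = {}"
proof -
  have op: "open (- A n)" if "n \<in> UNIV" for n
    using assms(1) algebra.compl_sets[OF cylinders_algebra, of "A n"]
    by (auto simp: Compl_eq_Diff_UNIV intro!: open_cylinder)
  have cover: "UNIV \<subseteq> (\<Union>n\<in>UNIV. - A n)" using assms(3) by blast
  obtain C where C: "finite C" "UNIV \<subseteq> (\<Union>n\<in>C. - A n)"
    using compactE_image[OF compact_config op cover] by metis
  have "A n = {}" if "Max C \<le> n" for n
  proof -
    have "A n \<subseteq> A m" if "m \<in> C" for m
      using decseqD[OF assms(2), of m n] Max_ge[OF C(1) that] \<open>Max C \<le> n\<close> by linarith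
    then show ?thesis using C(2) by blast
  qed
  then show ?thesis by blast
qed

text \<open>Limits of probabilities are finitely additive on cylinders, and
  \<open>decseq_cylinders_empty\<close> supplies the continuity for Caratheodory's extension
  theorem.\<close>

lemma limit_measure_exists:
  assumes \<mu>: "\<And>t. \<mu> t \<in> space (prob_algebra borel)"
    and conv: "\<And>A. A \<in> cylinders \<Longrightarrow> convergent (\<lambda>t. measure (\<mu> t) A)"
  obtains \<nu> where "\<nu> \<in> space (prob_algebra borel)"
    "\<And>A. A \<in> cylinders \<Longrightarrow> (\<lambda>t. measure (\<mu> t) A) \<longlonglongrightarrow> measure \<nu> A"
proof -
  interpret algebra "UNIV :: config set" cylinders by (rule cylinders_algebra)
  have prob: "prob_space (\<mu> t)" and sets: "sets (\<mu> t) = sets borel" for t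
    using \<mu>[of t] by (auto simp: space_prob_algebra)
  have space: "space (\<mu> t) = UNIV" for t using sets_eq_imp_space_eq[OF sets] by simp
  define m where "m A = lim (\<lambda>t. measure (\<mu> t) A)" for A
  have m: "(\<lambda>t. measure (\<mu> t) A) \<longlonglongrightarrow> m A" if "A \<in> cylinders" for A
    using conv[OF that] by (simp add: m_def convergent_LIMSEQ_iff)
  have m0: "0 \<le> m A" if "A \<in> cylinders" for A
    by (rule LIMSEQ_le_const[OF m[OF that]]) auto
  have m_empty: "m {} = 0" by (simp add: m_def)
  have m_UNIV: "m UNIV = 1"
    using prob_space.prob_space[OF prob] by (simp add: m_def space)
  have m_add: "m (A \<union> B) = m A + m B" if "A \<in> cylinders" "B \<in> cylinders" "A \<inter> B = {}" for A B
  proof -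
    have "measure (\<mu> t) (A \<union> B) = measure (\<mu> t) A + measure (\<mu> t) B" for t
      using that sets cylinder_borel prob_space.finite_measure[OF prob]
      by (intro finite_measure.finite_measure_Union) auto
    then have "(\<lambda>t. measure (\<mu> t) A + measure (\<mu> t) B) \<longlonglongrightarrow> m (A \<union> B)"
      using m[of "A \<union> B"] that by auto
    then show ?thesis
      using tendsto_add[OF m[OF that(1)] m[OF that(2)]] LIMSEQ_unique by blast
  qed
  have "\<exists>\<mu>' :: config set \<Rightarrow> ennreal. (\<forall>s \<in> cylinders. \<mu>' s = ennreal (m s)) \<and> measure_space UNIV (sigma_sets UNIV cylinders) \<mu>'"
  proof (rule caratheodory_empty_continuous)
    show "positive cylinders (\<lambda>A. ennreal (m A))" by (simp add: positive_def m_empty)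
    show "additive cylinders (\<lambda>A. ennreal (m A))"
      by (auto simp: additive_def m_add m0)
    fix A :: "nat \<Rightarrow> config set"
    assume "range A \<subseteq> cylinders" "decseq A" "(\<Inter>i. A i) = {}"
    then obtain N where "\<And>n. N \<le> n \<Longrightarrow> A n = {}" using decseq_cylinders_empty by blast
    then have "\<forall>\<^sub>F n in sequentially. ennreal (m (A n)) = 0"
      by (auto simp: eventually_sequentially m_empty intro!: exI[of _ N])
    then show "(\<lambda>n. ennreal (m (A n))) \<longlonglongrightarrow> 0" by (rule tendsto_eventually)
  qed simp
  then obtain \<mu>' :: "config set \<Rightarrow> ennreal" where \<mu>': "\<And>s. s \<in> cylinders \<Longrightarrow> \<mu>' s = ennreal (m s)"
    and ms: "measure_space UNIV (sigma_sets UNIV cylinders) \<mu>'" by blast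
  define \<nu> where "\<nu> = measure_of UNIV (sigma_sets UNIV cylinders) \<mu>'"
  have sets\<nu>: "sets \<nu> = sets borel"
    using sets.sigma_sets_eq[of "borel :: config measure"] unfolding \<nu>_def by (simp add: sigma_sets_cylinders)
  have space\<nu>: "space \<nu> = UNIV" unfolding \<nu>_def by simp
  have em: "emeasure \<nu> A = ennreal (m A)" if "A \<in> cylinders" for A
  proof -
    have "emeasure \<nu> A = \<mu>' A"
      using that ms unfolding \<nu>_def measure_space_def
      by (intro emeasure_measure_of_sigma) auto
    then show ?thesis using \<mu>' that by simp
  qed
  show ?thesis
  proof (rule that)
    have "prob_space \<nu>" by (rule prob_spaceI) (simp add: space\<nu> em top m_UNIV)
    then show "\<nu> \<in> space (prob_algebra borel)" by (simp add: space_prob_algebra sets\<nu>)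
    fix A assume A: "A \<in> cylinders"
    then have "measure \<nu> A = m A" using em m0 by (simp add: measure_def)
    then show "(\<lambda>t. measure (\<mu> t) A) \<longlonglongrightarrow> measure \<nu> A" using m[OF A] by simp
  qed
qed

definition truncate :: "nat \<Rightarrow> config \<Rightarrow> config" where
  "truncate n x = (\<lambda>i. if \<bar>i\<bar> \<le> int n then x i else False)"

text \<open>Around each configuration a finite window controls \<open>f\<close>; finitely many such
  neighbourhoods cover the space, and the largest window serves them all.\<close>

lemma continuous_truncate_approx:
  fixes f :: "config \<Rightarrow> real"
  assumes f: "continuous_on UNIV f" and e: "0 < e"
  obtains n where "\<And>x. \<bar>f x - f (truncate n x)\<bar> < e"
proof -
  have "\<exists>n. \<forall>y\<in>agreeing n x. \<bar>f y - f x\<bar> < e / 2" for x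
  proof -
    define U where "U = f -` ball (f x) (e / 2)"
    have U: "open U" "x \<in> U" unfolding U_def using f e by (auto intro: open_vimage)
    then have "openin (product_topology (\<lambda>_::int. euclidean :: bool topology) UNIV) U"
      by (simp add: open_fun_def)
    from product_topology_open_contains_basis[OF this U(2)]
    obtain X where X: "x \<in> (\<Pi>\<^sub>E i\<in>UNIV. X i)" "finite {i. X i \<noteq> UNIV}" "(\<Pi>\<^sub>E i\<in>UNIV. X i) \<subseteq> U"
      by auto
    define n where "n = nat (Max (insert 0 (abs ` {i. X i \<noteq> UNIV})))"
    have "agreeing n x \<subseteq> (\<Pi>\<^sub>E i\<in>UNIV. X i)"
    proof (clarsimp simp: PiE_iff)
      fix y i assume y: "y \<in> agreeing n x"
      show "y i \<in> X i"
      proof (cases "X i = UNIV")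
        case False
        then have "\<bar>i\<bar> \<le> Max (insert 0 (abs ` {i. X i \<noteq> UNIV}))"
          using X(2) by (intro Max_ge) auto
        then have "i \<in> {- int n..int n}" unfolding n_def by auto
        then have "y i = x i" using y by (simp add: agreeing_def)
        then show ?thesis using X(1) by (auto simp: PiE_iff)
      qed simp
    qed
    then have "agreeing n x \<subseteq> U" using X(3) by blast
    then show ?thesis by (intro exI[of _ n]) (auto simp: U_def dist_real_def abs_minus_commute)
  qed
  then obtain N where N: "\<And>x y. y \<in> agreeing (N x) x \<Longrightarrow> \<bar>f y - f x\<bar> < e / 2" by metis
  have cover: "UNIV \<subseteq> (\<Union>x\<in>UNIV. agreeing (N x) x)" by (auto simp: agreeing_def)
  obtain C where C: "finite C" "UNIV \<subseteq> (\<Union>x\<in>C. agreeing (N x) x)"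
    using compactE_image[OF compact_config open_agreeing cover] by metis
  define n where "n = Max (N ` C)"
  show ?thesis
  proof (rule that[of n])
    fix x
    \<comment> \<open>\<open>x\<close> and its truncation are compared through the common centre
      \<open>z\<close>, hence the two halves of \<open>e\<close>.\<close>
    obtain z where z: "z \<in> C" "x \<in> agreeing (N z) z" using C(2) by blast
    have "N z \<le> n" unfolding n_def using C(1) z(1) by simp
    then have "truncate n x \<in> agreeing (N z) z" using z(2) by (auto simp: agreeing_def truncate_def)
    then show "\<bar>f x - f (truncate n x)\<bar> < e" using N[OF z(2)] N[of "truncate n x" z] by linarith
  qed
qed

section \<open>Words read off a configuration\<close>

primrec word :: "int \<Rightarrow> nat \<Rightarrow> config \<Rightarrow> bool list" where
  "word i 0 x = []"
| "word i (Suc n) x = x i # word (i + 1) n x"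

lemma length_word [simp]: "length (word i n x) = n"
  by (induction n arbitrary: i) auto

lemma nth_word: "k < n \<Longrightarrow> word i n x ! k = x (i + int k)"
  by (induction n arbitrary: i k) (auto simp: nth_Cons ac_simps split: nat.split)

lemma window_dependent_as_word:
  assumes "window_dependent n f"
  shows "\<exists>g. \<forall>x. f x = g (map Some (word (- int n) (2 * n + 1) x))"
proof (intro exI allI)
  \<comment> \<open>The witness rebuilds a configuration from the word, with cell \<open>j\<close>
    at position \<open>j + n\<close>. Its values outside the window are arbitrary and invisible to
    \<open>f\<close>.\<close>
  show "f x = f (\<lambda>j. the (map Some (word (- int n) (2 * n + 1) x) ! nat (j + int n)))" for x
    by (rule window_dependentD[OF assms]) (auto simp: nth_word simp del: word.simps)
qed

lemma word_cong: "(\<And>j. i \<le> j \<Longrightarrow> j < i + int n \<Longrightarrow> x j = y j) \<Longrightarrow> word i n x = word i n y"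
  by (induction n arbitrary: i) auto

lemma window_dependent_word: "window_dependent n (\<lambda>x. g (word (- int n) (2 * n + 1) x))"
  unfolding window_dependent_def by (intro allI impI arg_cong[where f=g] word_cong) auto

lemma measurable_word: "word i n \<in> borel \<rightarrow>\<^sub>M count_space UNIV"
proof (induction n arbitrary: i)
  case (Suc n)
  have "(\<lambda>x. (x i, word (i + 1) n x)) \<in> borel \<rightarrow>\<^sub>M count_space UNIV \<Otimes>\<^sub>M count_space UNIV"
    by (intro measurable_Pair measurable_coordinate Suc)
  then have "(\<lambda>x. (x i, word (i + 1) n x)) \<in> borel \<rightarrow>\<^sub>M count_space UNIV"
    by (simp add: pair_measure_countable)
  from measurable_compose[OF this, of "\<lambda>(a, w). a # w" "count_space UNIV"]
  show ?case by simp
next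
  case 0
  have "word i 0 = (\<lambda>_. [])" by auto
  then show ?case by simp
qed

lemma borel_measurable_word: "(\<lambda>x. g (word i n x)) \<in> borel_measurable borel"
  by (rule measurable_compose[OF measurable_word]) simp

lemma bounded_word:
  fixes g :: "bool list \<Rightarrow> real"
  obtains B where "\<And>x. \<bar>g (word i n x)\<bar> \<le> B"
proof -
  have fin: "finite {w :: bool list. length w = n}"
    using finite_lists_length_eq[of "UNIV :: bool set" n] by simp
  show ?thesis
    by (rule that[of "Max ((\<lambda>w. \<bar>g w\<bar>) ` {w. length w = n})"]) (use fin in \<open>auto intro!: Max_ge\<close>)
qed

lemma integrable_word:
  fixes g :: "bool list \<Rightarrow> real"
  assumes "prob_space M" "sets M = sets borel"
  shows "integrable M (\<lambda>x. g (word i n x))"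
proof -
  interpret prob_space M by fact
  obtain B where "\<And>x. \<bar>g (word i n x)\<bar> \<le> B" using bounded_word[of g i n] by blast
  then show ?thesis
    using borel_measurable_word[of g i n] assms(2)
    by (intro integrable_const_bound[of _ B]) (auto simp: measurable_cong_sets[OF assms(2) refl])
qed

text \<open>A finite sum over cylinder probabilities, through which convergence on cylinders passes
  to integrals.\<close>

lemma integral_word:
  fixes g :: "bool list \<Rightarrow> real"
  assumes "prob_space M" "sets M = sets borel"
  shows "(LINT x|M. g (word i n x)) = (\<Sum>w\<in>{w. length w = n}. g w * measure M {x. word i n x = w})"
proof -
  interpret prob_space M by fact
  have fin: "finite {w :: bool list. length w = n}"
    using finite_lists_length_eq[of "UNIV :: bool set" n] by simp
  have space: "space M = UNIV" using sets_eq_imp_space_eq[OF assms(2)] by simp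
  have meas: "{x. word i n x = w} \<in> sets M" for w
    using measurable_sets[OF measurable_word, of "{w}" i n] by (simp add: assms(2) vimage_def)
  have "(LINT x|M. g (word i n x)) = (LINT x|M. (\<Sum>w\<in>{w. length w = n}. g w * indicator {x. word i n x = w} x))"
  proof (rule Bochner_Integration.integral_cong[OF refl])
    fix x
    have "(\<Sum>w\<in>{w. length w = n}. g w * indicator {x. word i n x = w} x)
        = (\<Sum>w\<in>{word i n x}. g w * indicator {x. word i n x = w} x)"
      using fin by (intro sum.mono_neutral_right) auto
    then show "g (word i n x) = (\<Sum>w\<in>{w. length w = n}. g w * indicator {x. word i n x = w} x)" by simp
  qed
  also have "\<dots> = (\<Sum>w\<in>{w. length w = n}. g w * measure M {x. word i n x = w})"
    using meas by (subst Bochner_Integration.integral_sum) (auto simp: space emeasure_eq_measure)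
  finally show ?thesis .
qed

text \<open>Both integrals lie within \<open>e\<close> of the value of \<open>f\<close> at one
  common point, hence the factor 2.\<close>

lemma integral_oscillation:
  fixes f :: "'a \<Rightarrow> real"
  assumes "prob_space M" "prob_space N" "integrable M f" "integrable N f"
    and osc: "\<And>x y. \<bar>f x - f y\<bar> \<le> e"
  shows "\<bar>(LINT x|M. f x) - (LINT x|N. f x)\<bar> \<le> 2 * e"
proof -
  have *: "\<bar>(LINT x|K. f x) - f y\<bar> \<le> e" if "prob_space K" "integrable K f" for K y
  proof -
    interpret prob_space K by fact
    have "(LINT x|K. f x - f y) = (LINT x|K. f x) - f y"
      using that(2) by (simp add: prob_space)
    moreover have "\<bar>LINT x|K. f x - f y\<bar> \<le> (LINT x|K. \<bar>f x - f y\<bar>)" by (rule integral_abs_bound)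
    moreover have "(LINT x|K. \<bar>f x - f y\<bar>) \<le> (LINT x|K. e)"
      using that(2) osc by (intro integral_mono) auto
    ultimately show ?thesis by (simp add: prob_space)
  qed
  show ?thesis using *[OF assms(1,3), of undefined] *[OF assms(2,4), of undefined] by linarith
qed

section \<open>Laws of the automaton and convergence\<close>

context noisy_rule
begin

context
  fixes p :: param
  assumes entry_p: "\<And>x y. entry p x y = (if f x y then 1 - \<epsilon> else \<epsilon>)"
begin

lemma kernel_cylinder:
  assumes "finite J"
  shows "measure (pca_kernel p x) {y. \<forall>j\<in>J. y j = z j} =
    (\<Prod>j\<in>J. pmf (bernoulli_pmf (entry p (x j) (x (j + 1)))) (z j))"
proof -
  let ?M = "\<lambda>i. measure_pmf (bernoulli_pmf (entry p (x i) (x (i + 1))))"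
  interpret product_prob_space ?M UNIV
    by (intro product_prob_spaceI prob_space_measure_pmf)
  have "{y. \<forall>j\<in>J. y j = z j} = prod_emb UNIV ?M J (\<Pi>\<^sub>E j\<in>J. {z j})"
    by (auto simp: prod_emb_def PiE_iff restrict_def extensional_def)
  then show ?thesis
    unfolding pca_kernel_def using assms by (simp add: measure_PiM_emb measure_pmf_single)
qed

text \<open>The cylinder condition to the left of the word serves the induction: the first cell of
  the word is split by its value and moved into \<open>J\<close>, until only a product of
  independent factors remains. The application takes \<open>J\<close> empty.\<close>

lemma integral_kernel_cylinder_word:
  assumes "finite J" "J \<subseteq> {..<i}"
  shows "(LINT y|pca_kernel p x. of_bool (\<forall>j\<in>J. y j = z j) * g (map Some (word i n y))) =
    (\<Prod>j\<in>J. pmf (bernoulli_pmf (entry p (x j) (x (j + 1)))) (z j)) * step g (map Some (word i (Suc n) x))"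
  using assms
proof (induction n arbitrary: i J z g)
  case 0
  interpret prob_space "pca_kernel p x" by (rule prob_space_pca_kernel)
  have "(\<lambda>y. of_bool (\<forall>j\<in>J. y j = z j)) = (indicator {y. \<forall>j\<in>J. y j = z j} :: config \<Rightarrow> real)"
    by (auto simp: indicator_def)
  moreover have "space (pca_kernel p x) = UNIV"
    using sets_eq_imp_space_eq[OF sets_pca_kernel] by simp
  ultimately have "(LINT y|pca_kernel p x. of_bool (\<forall>j\<in>J. y j = z j)) = measure (pca_kernel p x) {y. \<forall>j\<in>J. y j = z j}"
    by simp
  then show ?case using kernel_cylinder[OF 0(1)] by simp
next
  case (Suc n)
  interpret prob_space "pca_kernel p x" by (rule prob_space_pca_kernel)
  let ?q = "\<lambda>j c. pmf (bernoulli_pmf (entry p (x j) (x (j + 1)))) c"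
  let ?J = "insert i J"
  have iJ: "i \<notin> J" using Suc.prems by auto
  define h where "h c y = of_bool (\<forall>j\<in>?J. y j = (z(i := c)) j) * g (Some c # map Some (word (i + 1) n y))" for c y
  have split: "of_bool (\<forall>j\<in>J. y j = z j) * g (map Some (word i (Suc n) y)) = h True y + h False y" for y
    using iJ by (cases "y i") (auto simp: h_def intro!: arg_cong2[where f="(*)"] arg_cong[where f=of_bool])
  have int: "integrable (pca_kernel p x) (h c)" for c
  proof -
    obtain B where B: "\<And>y. \<bar>g (Some c # map Some (word (i + 1) n y))\<bar> \<le> B"
      using bounded_word[of "\<lambda>w. g (Some c # map Some w)" "i + 1" n] by blast
    have "{y. \<forall>j\<in>?J. y j = (z(i := c)) j} \<in> sets borel"
    proof -
      have "open {y. \<forall>j\<in>?J. y j \<in> {(z(i := c)) j}}"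
        using Suc.prems(1) product_topology_basis'[of ?J "\<lambda>j. {(z(i := c)) j}" "\<lambda>j. j"]
        by (auto simp: Topological_Spaces.open_discrete)
      then show ?thesis by (simp add: borel_open)
    qed
    then have "(\<lambda>y. indicator {y. \<forall>j\<in>?J. y j = (z(i := c)) j} y * (\<lambda>w. g (Some c # map Some w)) (word (i + 1) n y))
      \<in> borel_measurable borel"
      by (intro borel_measurable_times borel_measurable_indicator borel_measurable_word)
    moreover have "h c = (\<lambda>y. indicator {y. \<forall>j\<in>?J. y j = (z(i := c)) j} y * (\<lambda>w. g (Some c # map Some w)) (word (i + 1) n y))"
      unfolding h_def by (intro ext) (simp only: indicator_def mem_Collect_eq)
    ultimately have "h c \<in> borel_measurable (pca_kernel p x)"
      by (simp only: measurable_cong_sets[OF sets_pca_kernel refl])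
    moreover have "\<bar>h c y\<bar> \<le> B" for y
      using B[of y] by (auto simp: h_def)
    ultimately show ?thesis by (intro integrable_const_bound[of _ B]) auto
  qed
  have each: "(LINT y|pca_kernel p x. h c y) =
      ?q i c * ((\<Prod>j\<in>J. ?q j (z j)) * step (\<lambda>w. g (Some c # w)) (map Some (word (i + 1) (Suc n) x)))" for c
  proof -
    have "(\<Prod>j\<in>?J. ?q j ((z(i := c)) j)) = ?q i c * (\<Prod>j\<in>J. ?q j (z j))"
      using iJ Suc.prems(1) by (simp add: prod.insert) (auto intro!: prod.cong)
    moreover have "?J \<subseteq> {..<i + 1}" "finite ?J" using Suc.prems by auto
    ultimately show ?thesis
      unfolding h_def using Suc.IH[of ?J "i + 1" "z(i := c)" "\<lambda>w. g (Some c # w)"] by simp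
  qed
  have e: "entry p a b \<in> {0..1}" for a b using eps by (auto simp: entry_p)
  have "(LINT y|pca_kernel p x. of_bool (\<forall>j\<in>J. y j = z j) * g (map Some (word i (Suc n) y))) =
      (\<Prod>j\<in>J. ?q j (z j)) * (?q i True * step (\<lambda>w. g (Some True # w)) (map Some (word (i + 1) (Suc n) x))
        + ?q i False * step (\<lambda>w. g (Some False # w)) (map Some (word (i + 1) (Suc n) x)))"
    unfolding split using int by (simp add: each algebra_simps)
  \<comment> \<open>The kernel gives the rule's value probability 1 - \<epsilon> = \<epsilon> +
    \<eta> and the other value \<epsilon>, which are the weights in \<open>step\<close>.\<close>
  also have "?q i True * step (\<lambda>w. g (Some True # w)) (map Some (word (i + 1) (Suc n) x))
        + ?q i False * step (\<lambda>w. g (Some False # w)) (map Some (word (i + 1) (Suc n) x))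
      = step g (map Some (word i (Suc (Suc n)) x))"
    using eps by (simp add: entry_p \<eta>_def algebra_simps)
  finally show ?case .
qed

lemma integral_kernel_word:
  "(LINT y|pca_kernel p x. g (map Some (word i n y))) = step g (map Some (word i (Suc n) x))"
  using integral_kernel_cylinder_word[of "{}" i x _ g n] by simp

text \<open>Evolving the law is dual to applying \<open>step\<close> to the observable. Each time
  step widens the window by one cell on the right.\<close>

lemma integral_law_word:
  assumes \<mu>: "\<mu> \<in> space (prob_algebra borel)"
  shows "(LINT y|pca_law p \<mu> t. g (map Some (word i n y))) = (LINT x|\<mu>. (step ^^ t) g (map Some (word i (n + t) x)))"
proof (induction t arbitrary: g n)
  case (Suc t)
  let ?\<mu> = "pca_law p \<mu> t"
  have L: "?\<mu> \<in> space (prob_algebra borel)" by (rule pca_law_in_prob_algebra[OF \<mu>])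
  then interpret prob_space ?\<mu> by (simp add: space_prob_algebra)
  have sets: "sets ?\<mu> = sets borel" using L by (simp add: space_prob_algebra)
  obtain B where B: "\<And>y. \<bar>g (map Some (word i n y))\<bar> \<le> B"
    using bounded_word[of "\<lambda>w. g (map Some w)" i n] by blast
  have "(LINT y|pca_law p \<mu> (Suc t). g (map Some (word i n y)))
      = (LINT x|?\<mu>. LINT y|pca_kernel p x. g (map Some (word i n y)))"
    unfolding pca_law.simps
  proof (rule integral_bind[where K=borel and B=B and B'=1])
    show "(\<lambda>y. g (map Some (word i n y))) \<in> borel_measurable borel" by (rule borel_measurable_word)
    show "\<bar>g (map Some (word i n y))\<bar> \<le> B" for y using B by simp
    show "pca_kernel p \<in> ?\<mu> \<rightarrow>\<^sub>M subprob_algebra borel"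
      using measurable_prob_algebraD[OF measurable_pca_kernel] by (simp add: measurable_cong_sets[OF sets refl])
    show "finite_measure ?\<mu>" by unfold_locales
    show "AE x in ?\<mu>. emeasure (pca_kernel p x) (space (pca_kernel p x)) \<le> ennreal 1"
      using prob_space.emeasure_space_1[OF prob_space_pca_kernel] by simp
  qed
  also have "\<dots> = (LINT x|?\<mu>. step g (map Some (word i (Suc n) x)))"
    by (simp only: integral_kernel_word)
  also have "\<dots> = (LINT x|\<mu>. (step ^^ t) (step g) (map Some (word i (Suc n + t) x)))"
    by (rule Suc.IH)
  finally show ?case by (simp add: funpow_swap1)
qed simp

lemma pca_law_add: "pca_law p \<mu> (s + t) = pca_law p (pca_law p \<mu> s) t"
  by (induction t) auto

text \<open>Both laws arise by \<open>T\<close> further steps from laws at earlier times, and the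
  \<open>T\<close>-fold iterate of \<open>g\<close> is nearly constant on known words. One estimate
  thus gives convergence in time and independence of the initial law.\<close>

lemma law_word_cauchy:
  fixes g :: "bool option list \<Rightarrow> real"
  assumes forgets and e: "0 < e"
  obtains T where "\<And>\<mu> \<mu>' t t'. \<mu> \<in> space (prob_algebra borel) \<Longrightarrow> \<mu>' \<in> space (prob_algebra borel) \<Longrightarrow> T \<le> t \<Longrightarrow> T \<le> t' \<Longrightarrow>
    \<bar>(LINT x|pca_law p \<mu> t. g (map Some (word i n x))) - (LINT x|pca_law p \<mu>' t'. g (map Some (word i n x)))\<bar> \<le> e"
proof -
  \<comment> \<open>Half of \<open>e\<close>, because \<open>integral_oscillation\<close> doubles
    the bound.\<close>
  obtain T where T: "\<And>v v'. length v = n + T \<Longrightarrow> length v' = n + T \<Longrightarrow>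
      \<bar>(step ^^ T) g (map Some v) - (step ^^ T) g (map Some v')\<bar> \<le> e / 2"
    using assms unfolding forgets_def by (metis half_gt_zero)
  show ?thesis
  proof (rule that[of T])
    fix \<mu> \<mu>' :: "config measure" and t t' assume \<mu>: "\<mu> \<in> space (prob_algebra borel)" "\<mu>' \<in> space (prob_algebra borel)" and t: "T \<le> t" "T \<le> t'"
    let ?h = "\<lambda>x. (step ^^ T) g (map Some (word i (n + T) x))"
    have *: "(LINT x|pca_law p \<mu> t. g (map Some (word i n x))) = (LINT x|pca_law p \<mu> (t - T). ?h x)"
      if "\<mu> \<in> space (prob_algebra borel)" "T \<le> t" for \<mu> t
      using integral_law_word[OF pca_law_in_prob_algebra[OF that(1)], of p "t - T" T g i n]
        pca_law_add[of \<mu> "t - T" T] that(2) by simp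
    have "integrable (pca_law p \<mu> s) ?h" "prob_space (pca_law p \<mu> s)"
      if "(\<mu> :: config measure) \<in> space (prob_algebra borel)" for \<mu> s
      using pca_law_in_prob_algebra[OF that, of p s]
        integrable_word[of "pca_law p \<mu> s" "\<lambda>w. (step ^^ T) g (map Some w)"] by (auto simp: space_prob_algebra)
    then have "\<bar>(LINT x|pca_law p \<mu> (t - T). ?h x) - (LINT x|pca_law p \<mu>' (t' - T). ?h x)\<bar> \<le> 2 * (e / 2)"
      using \<mu> T by (intro integral_oscillation) auto
    then show "\<bar>(LINT x|pca_law p \<mu> t. g (map Some (word i n x))) - (LINT x|pca_law p \<mu>' t'. g (map Some (word i n x)))\<bar> \<le> e"
      using *[OF \<mu>(1) t(1)] *[OF \<mu>(2) t(2)] by simp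
  qed
qed

text \<open>The limit measure is built from one reference start, the all-zero configuration;
  \<open>law_word_cauchy\<close> transfers the convergence to every other start.\<close>

lemma forgets_imp_ergodic:
  assumes forgets
  shows "pca_ergodic p"
proof -
  define \<mu>0 where "\<mu>0 = return borel (\<lambda>_::int. False)"
  have \<mu>0: "\<mu>0 \<in> space (prob_algebra borel)"
    by (simp add: \<mu>0_def space_prob_algebra prob_space_return)
  have conv_word: "convergent (\<lambda>t. LINT x|pca_law p \<mu>0 t. g (map Some (word i n x)))" for g :: "bool option list \<Rightarrow> real" and i n
  proof (rule real_Cauchy_convergent, rule CauchyI')
    fix e :: real assume e: "0 < e"
    then obtain T where T: "\<And>t t'. T \<le> t \<Longrightarrow> T \<le> t' \<Longrightarrow>
      \<bar>(LINT x|pca_law p \<mu>0 t. g (map Some (word i n x))) - (LINT x|pca_law p \<mu>0 t'. g (map Some (word i n x)))\<bar> \<le> e / 2"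
      using law_word_cauchy[OF assms, of "e / 2"] \<mu>0 by (metis half_gt_zero)
    show "\<exists>M. \<forall>m\<ge>M. \<forall>n'>m. dist (LINT x|pca_law p \<mu>0 m. g (map Some (word i n x)))
        (LINT x|pca_law p \<mu>0 n'. g (map Some (word i n x))) < e"
    proof (intro exI[of _ T] allI impI)
      fix m n' assume "T \<le> m" "m < n'"
      then show "dist (LINT x|pca_law p \<mu>0 m. g (map Some (word i n x)))
        (LINT x|pca_law p \<mu>0 n'. g (map Some (word i n x))) < e"
        using T[of m n'] e unfolding dist_real_def by linarith
    qed
  qed
  have conv: "convergent (\<lambda>t. measure (pca_law p \<mu>0 t) A)" if A: "A \<in> cylinders" for A
  proof -
    obtain n where "window_dependent n (\<lambda>x. x \<in> A)" using A by (auto simp: cylinders_def)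
    then have "window_dependent n (indicator A :: config \<Rightarrow> real)" by (auto simp: window_dependent_def indicator_def)
    from window_dependent_as_word[OF this] obtain g :: "bool option list \<Rightarrow> real"
      where g: "indicator A = (\<lambda>x. g (map Some (word (- int n) (2 * n + 1) x)))" by blast
    have "measure (pca_law p \<mu>0 t) A = (LINT x|pca_law p \<mu>0 t. indicator A x)" for t
      using sets_eq_imp_space_eq[of "pca_law p \<mu>0 t" borel] pca_law_in_prob_algebra[OF \<mu>0, of p t]
      by (simp add: space_prob_algebra)
    then show ?thesis using conv_word[of g "- int n" "2 * n + 1"] by (simp only: g)
  qed
  obtain \<nu> where \<nu>: "\<nu> \<in> space (prob_algebra borel)"
    and lim: "\<And>A. A \<in> cylinders \<Longrightarrow> (\<lambda>t. measure (pca_law p \<mu>0 t) A) \<longlonglongrightarrow> measure \<nu> A"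
    using limit_measure_exists[of "pca_law p \<mu>0", OF pca_law_in_prob_algebra[OF \<mu>0] conv] by blast
  have lim_word: "(\<lambda>t. LINT x|pca_law p \<mu>0 t. g (word (- int n) (2 * n + 1) x)) \<longlonglongrightarrow> (LINT x|\<nu>. g (word (- int n) (2 * n + 1) x))"
    for g :: "bool list \<Rightarrow> real" and n
  proof -
    have "{x. word (- int n) (2 * n + 1) x = w} \<in> cylinders" for w
      using window_dependent_word[of n "\<lambda>v. v = w"] by (auto simp: cylinders_def)
    then have "(\<lambda>t. \<Sum>w\<in>{w. length w = 2 * n + 1}. g w * measure (pca_law p \<mu>0 t) {x. word (- int n) (2 * n + 1) x = w})
      \<longlonglongrightarrow> (\<Sum>w\<in>{w. length w = 2 * n + 1}. g w * measure \<nu> {x. word (- int n) (2 * n + 1) x = w})"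
      by (intro tendsto_sum tendsto_mult tendsto_const lim)
    then show ?thesis
      using pca_law_in_prob_algebra[OF \<mu>0, of p] \<nu> by (simp only: integral_word space_prob_algebra mem_Collect_eq)
  qed
  have "weakly_converges (pca_law p \<mu>) \<nu>" if \<mu>: "\<mu> \<in> space (prob_algebra borel)" for \<mu>
    unfolding weakly_converges_def
  proof (intro allI impI)
    fix F :: "config \<Rightarrow> real" assume F: "continuous_on UNIV F \<and> bounded (range F)"
    then have "\<exists>B. \<forall>x. \<bar>F x\<bar> \<le> B" by (simp add: bounded_iff)
    then obtain B where B: "\<And>x. \<bar>F x\<bar> \<le> B" by blast
    have intF: "integrable M F" if "M \<in> space (prob_algebra borel)" for M
    proof -
      interpret prob_space M using that by (simp add: space_prob_algebra)
      have "sets M = sets borel" using that by (simp add: space_prob_algebra)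
      then have "F \<in> borel_measurable M"
        using borel_measurable_continuous_onI[of F] F by (simp only: measurable_cong_sets[of M borel borel borel])
      then show ?thesis using B by (intro integrable_const_bound[of _ B]) auto
    qed
    show "(\<lambda>t. LINT x|pca_law p \<mu> t. F x) \<longlonglongrightarrow> (LINT x|\<nu>. F x)"
    proof (rule LIMSEQ_I)
      fix e :: real assume e: "0 < e"
      \<comment> \<open>Four errors of at most \<open>e / 5\<close>: replacing \<open>F\<close> by a
        window function under both measures, changing the initial law to \<open>\<mu>0\<close>, and
        passing to the limit.\<close>
      obtain n where n: "\<And>x. \<bar>F x - F (truncate n x)\<bar> < e / 5"
        using continuous_truncate_approx[of F "e / 5"] F e by auto
      have "window_dependent n (\<lambda>x. F (truncate n x))"
        unfolding window_dependent_def
      proof (intro allI impI arg_cong[where f=F])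
        fix x y :: config assume "\<forall>i\<in>{- int n..int n}. x i = y i"
        then show "truncate n x = truncate n y" by (simp add: truncate_def fun_eq_iff abs_le_iff)
      qed
      from window_dependent_as_word[OF this] obtain g
        where g: "\<And>x. F (truncate n x) = g (map Some (word (- int n) (2 * n + 1) x))" by blast
      let ?G = "\<lambda>x. g (map Some (word (- int n) (2 * n + 1) x))"
      have close: "\<bar>(LINT x|M. F x) - (LINT x|M. ?G x)\<bar> \<le> e / 5" if M: "M \<in> space (prob_algebra borel)" for M
      proof -
        interpret prob_space M using M by (simp add: space_prob_algebra)
        have G: "integrable M ?G"
          using integrable_word[of M "\<lambda>w. g (map Some w)"] M by (simp add: space_prob_algebra del: word.simps)
        have "(LINT x|M. F x) - (LINT x|M. ?G x) = (LINT x|M. F x - ?G x)"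
          using intF[OF M] G by simp
        moreover have "\<bar>LINT x|M. F x - ?G x\<bar> \<le> (LINT x|M. \<bar>F x - ?G x\<bar>)" by (rule integral_abs_bound)
        moreover have "(LINT x|M. \<bar>F x - ?G x\<bar>) \<le> (LINT x|M. e / 5)"
          using intF[OF M] G n by (intro integral_mono) (auto simp: g less_imp_le)
        moreover have "(LINT x|M. e / 5) = e / 5" by (simp add: prob_space)
        ultimately show ?thesis by linarith
      qed
      obtain T where T: "\<And>\<mu> \<mu>' t t'. \<mu> \<in> space (prob_algebra borel) \<Longrightarrow> \<mu>' \<in> space (prob_algebra borel) \<Longrightarrow> T \<le> t \<Longrightarrow> T \<le> t' \<Longrightarrow>
          \<bar>(LINT x|pca_law p \<mu> t. ?G x) - (LINT x|pca_law p \<mu>' t'. ?G x)\<bar> \<le> e / 5"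
        using law_word_cauchy[OF assms, of "e / 5" g "- int n" "2 * n + 1"] e by auto
      obtain S where S: "\<And>t. S \<le> t \<Longrightarrow> \<bar>(LINT x|pca_law p \<mu>0 t. ?G x) - (LINT x|\<nu>. ?G x)\<bar> < e / 5"
        using LIMSEQ_D[OF lim_word[of "\<lambda>w. g (map Some w)" n], of "e / 5"] e by auto
      show "\<exists>N. \<forall>t\<ge>N. norm ((LINT x|pca_law p \<mu> t. F x) - (LINT x|\<nu>. F x)) < e"
      proof (intro exI[of _ "max S T"] allI impI)
        fix t assume t: "max S T \<le> t"
        show "norm ((LINT x|pca_law p \<mu> t. F x) - (LINT x|\<nu>. F x)) < e"
          using close[OF \<nu>] close[OF pca_law_in_prob_algebra[OF \<mu>], of p t] T[OF \<mu> \<mu>0, of t t] S[of t] t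
          unfolding real_norm_def by linarith
      qed
    qed
  qed
  then show ?thesis unfolding pca_ergodic_def using \<nu> by blast
qed

end

end

section \<open>All rules except exclusive or and its negation\<close>

theorem theorem1:
  fixes p :: param and \<epsilon> :: real
  assumes "p \<in> ({0, 1} \<times> {0, 1} \<times> {0, 1} \<times> {0, 1}) - {(1, 0, 0, 1), (0, 1, 1, 0)}"
    and "\<epsilon> \<in> {0<..1/2}"
  shows "pca_ergodic (ca_with_error p \<epsilon>)"
proof -
  obtain a b c d where p: "p = (a, b, c, d)" by (cases p)
  have abcd: "a \<in> {0, 1}" "b \<in> {0, 1}" "c \<in> {0, 1}" "d \<in> {0, 1}"
    "(a, b, c, d) \<noteq> (1, 0, 0, 1)" "(a, b, c, d) \<noteq> (0, 1, 1, 0)"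
    using assms(1) unfolding p by auto
  define f where "f x y \<longleftrightarrow> entry p x y = 1" for x y
  have f_simps: "f False False \<longleftrightarrow> a = 1" "f False True \<longleftrightarrow> b = 1" "f True False \<longleftrightarrow> c = 1" "f True True \<longleftrightarrow> d = 1"
    by (simp_all add: f_def p)
  interpret noisy_rule f \<epsilon> using assms(2) by unfold_locales auto
  have "entry (ca_with_error p \<epsilon>) x y = (if f x y then 1 - \<epsilon> else \<epsilon>)" for x y
    using abcd by (cases x; cases y) (auto simp: f_def p noisy_def)
  moreover have forgets
  proof -
    \<comment> \<open>Of the 16 rules, 6 depend on at most one input and each of the other four
      cases contains 2; exclusive or and its negation are left over.\<close>
    consider "(\<forall>x y z. f x y = f x z) \<or> (\<forall>x y z. f x z = f y z)"
      | \<alpha> where "\<And>x y. f x y = (if x = \<alpha> \<and> y \<noteq> \<alpha> then \<alpha> else \<not> \<alpha>)"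
      | \<alpha> where "\<And>x y. f x y = (if x \<noteq> \<alpha> \<and> y = \<alpha> then \<alpha> else \<not> \<alpha>)"
      | \<beta> where "\<And>x y. f x y = (if x = \<beta> \<and> y = \<beta> then \<not> \<beta> else \<beta>)"
      | \<beta> where "\<And>x y. f x y = (if x = \<beta> \<and> y = \<beta> then \<beta> else \<not> \<beta>)"
    proof -
      have "((\<forall>x y z. f x y = f x z) \<or> (\<forall>x y z. f x z = f y z))
        \<or> (\<exists>\<alpha>. \<forall>x y. f x y = (if x = \<alpha> \<and> y \<noteq> \<alpha> then \<alpha> else \<not> \<alpha>))
        \<or> (\<exists>\<alpha>. \<forall>x y. f x y = (if x \<noteq> \<alpha> \<and> y = \<alpha> then \<alpha> else \<not> \<alpha>))
        \<or> (\<exists>\<beta>. \<forall>x y. f x y = (if x = \<beta> \<and> y = \<beta> then \<not> \<beta> else \<beta>))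
        \<or> (\<exists>\<beta>. \<forall>x y. f x y = (if x = \<beta> \<and> y = \<beta> then \<beta> else \<not> \<beta>))"
        using abcd unfolding all_bool_eq ex_bool_eq f_simps by auto
      then show thesis using that by blast
    qed
    then show forgets
      by cases (fact forgets_one_sided forgets_shift_type forgets_shift_type_reflected forgets_nand_type forgets_and_type)+
  qed
  ultimately show ?thesis by (rule forgets_imp_ergodic)
qed

end
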